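(* Let $m\ge1$ and let $\alpha_1,\dots,\alpha_m,\beta_1,\dots,\beta_m$ be real numbers such that $1,\alpha_1,\dots,\alpha_m,\beta_1,\dots,\beta_m$ are linearly independent over $\mathbb{Q}$. Then for every continuous function $\varphi$ on $\mathbb{T}=\mathbb{R}/\mathbb{Z}$ with $\int_{\mathbb{T}}\varphi(x)\,dx=0$, the sequence $$n\mapsto \varphi\big(n\alpha_1[n\beta_1]+\cdots+n\alpha_m[n\beta_m]\big)$$ is fully oscillating.
   Context: $[y]$ denotes the integer part of a real number $y$; $\varphi$ is viewed as a $1$-periodic function on $\mathbb{R}$. A sequence $(w_n)_{n\ge0}$ of complex numbers is oscillating of order $d\ge1$ if $\lim_{N\to\infty}\frac1N\sum_{n=0}^{N-1}w_ne^{2\pi iP(n)}=0$ for every real polynomial $P$ of degree at most $d$; it is fully oscillating if it is oscillating of every order $d\ge1$. *)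

theory Defs
  imports "HOL-Analysis.Analysis" "HOL-Computational_Algebra.Polynomial"
begin

definition oscillating_of_order :: "nat \<Rightarrow> (nat \<Rightarrow> complex) \<Rightarrow> bool" where
  "oscillating_of_order d w \<longleftrightarrow>
     (\<forall>P :: real poly. degree P \<le> d \<longrightarrow>
        (\<lambda>N. (\<Sum>n<N. w n * exp (2 * pi * \<i> * complex_of_real (poly P (real n)))) / of_nat N)
          \<longlonglongrightarrow> 0)"

definition fully_oscillating :: "(nat \<Rightarrow> complex) \<Rightarrow> bool" where
  "fully_oscillating w \<longleftrightarrow> (\<forall>d\<ge>1. oscillating_of_order d w)"

definition Q_lin_indep_1_ab :: "nat \<Rightarrow> (nat \<Rightarrow> real) \<Rightarrow> (nat \<Rightarrow> real) \<Rightarrow> bool" where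
  "Q_lin_indep_1_ab m \<alpha> \<beta> \<longleftrightarrow>
     (\<forall>(c::rat) (a::nat \<Rightarrow> rat) (b::nat \<Rightarrow> rat).
        of_rat c + (\<Sum>i<m. of_rat (a i) * \<alpha> i) + (\<Sum>i<m. of_rat (b i) * \<beta> i) = 0
        \<longrightarrow> c = 0 \<and> (\<forall>i<m. a i = 0 \<and> b i = 0))"

end

theory Submission
  imports Defs "HOL-Library.Periodic_Fun"
begin

text \<open>By Weierstrass approximation and rescaling of the \<open>\<alpha> i\<close> it suffices that
  \<open>u n = e(s n + P n)\<close> has mean 0, where \<open>e(x) = exp(2 \<pi> i x)\<close>,
  \<open>s n = (\<Sum>i. n \<alpha> i [n \<beta> i])\<close> and \<open>P\<close> is a real polynomial. By van der Corput's inequality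
  it is enough that the correlations \<open>u (n + h) * cnj (u n)\<close> have mean 0 for all large \<open>h\<close>.
  Since \<open>[(n + h) \<beta>] - [n \<beta>]\<close> takes only the values \<open>[h \<beta>]\<close> and \<open>[h \<beta>] + 1\<close>, depending
  on \<open>n \<beta>\<close> modulo 1, such a correlation is approximable in mean by combinations of
  \<open>e(g n + P (n + h) - P n)\<close> with
  \<open>g = (\<Sum>i. \<alpha> i * c i + h * \<alpha> i * \<beta> i + k i * \<beta> i)\<close>, where \<open>c i\<close> is one of the two values
  and \<open>k i\<close> an integer. By Weyl's theorem their means vanish
  unless all nonconstant coefficients of the polynomial are rational. Two bad values of \<open>h\<close>
  eliminate the unknown numbers \<open>\<alpha> i * \<beta> i\<close> and the quadratic coefficient of \<open>P\<close>, and linear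
  independence then allows only finitely many bad \<open>h\<close>.\<close>

subsection \<open>Cesaro means and van der Corput's inequality\<close>

definition cesaro :: "(nat \<Rightarrow> 'a::real_normed_field) \<Rightarrow> nat \<Rightarrow> 'a" where
  "cesaro w N = (\<Sum>n<N. w n) / of_nat N"

lemma cesaro_add: "cesaro (\<lambda>n. v n + w n) N = cesaro v N + cesaro w N"
  by (simp add: cesaro_def sum.distrib add_divide_distrib)

lemma cesaro_mult: "cesaro (\<lambda>n. c * w n) N = c * cesaro w N"
  by (simp add: cesaro_def sum_distrib_left)

lemma cesaro_sum: "cesaro (\<lambda>n. \<Sum>j\<in>J. w j n) N = (\<Sum>j\<in>J. cesaro (w j) N)"
  unfolding cesaro_def by (simp add: sum_divide_distrib sum.swap[of _ J])

lemma norm_cesaro_le: "norm (cesaro w N) \<le> cesaro (\<lambda>n. norm (w n)) N"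
  by (simp add: cesaro_def norm_divide divide_right_mono norm_sum)

lemma cesaro_mono:
  fixes v w :: "nat \<Rightarrow> real"
  shows "(\<And>n. v n \<le> w n) \<Longrightarrow> cesaro v N \<le> cesaro w N"
  by (simp add: cesaro_def divide_right_mono sum_mono)

lemma cesaro_const_le: "c \<ge> 0 \<Longrightarrow> cesaro (\<lambda>n. c) N \<le> (c::real)"
  by (cases "N = 0") (simp_all add: cesaro_def)

lemma tendsto_0I_eventually_norm_le:
  fixes f :: "nat \<Rightarrow> 'a::real_normed_vector"
  assumes "\<And>\<epsilon>. \<epsilon> > 0 \<Longrightarrow> \<forall>\<^sub>F N in sequentially. norm (f N) \<le> \<epsilon>"
  shows "f \<longlonglongrightarrow> 0"
proof (rule tendstoI)
  fix e :: real assume "e > 0"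
  then have "\<forall>\<^sub>F N in sequentially. norm (f N) \<le> e/2" using assms[of "e/2"] by simp
  then show "\<forall>\<^sub>F N in sequentially. dist (f N) 0 < e"
    by (rule eventually_mono) (use \<open>e > 0\<close> in auto)
qed

text \<open>For a single step the difference of the two sums telescopes to two boundary terms, which
  are negligible after division by \<open>N\<close>.\<close>

lemma cesaro_shift:
  fixes w :: "nat \<Rightarrow> 'a::real_normed_field"
  assumes bd: "\<And>n. norm (w n) \<le> C"
  shows "(\<lambda>N. cesaro (\<lambda>n. w (n + k)) N - cesaro w N) \<longlonglongrightarrow> 0"
proof (induction k)
  case (Suc k)
  have "(\<lambda>N. cesaro (\<lambda>n. w (n + Suc k)) N - cesaro (\<lambda>n. w (n + k)) N) \<longlonglongrightarrow> 0"
  proof (rule Lim_null_comparison)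
    show "\<forall>\<^sub>F N in sequentially.
        norm (cesaro (\<lambda>n. w (n + Suc k)) N - cesaro (\<lambda>n. w (n + k)) N) \<le> 2 * C / real N"
    proof (rule always_eventually, rule allI)
      fix N
      have "(\<Sum>n<N. w (n + Suc k)) - (\<Sum>n<N. w (n + k)) = w (N + k) - w k"
        by (induction N) (auto simp: algebra_simps)
      moreover have "norm (w (N + k) - w k) \<le> 2 * C"
        using norm_triangle_ineq4[of "w (N + k)" "w k"] bd[of "N + k"] bd[of k] by linarith
      ultimately show "norm (cesaro (\<lambda>n. w (n + Suc k)) N - cesaro (\<lambda>n. w (n + k)) N) \<le> 2 * C / real N"
        by (simp add: cesaro_def diff_divide_distrib[symmetric] norm_divide divide_right_mono)
    qed
    show "(\<lambda>N. 2 * C / real N) \<longlonglongrightarrow> 0"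
      by (rule tendsto_divide_0[OF tendsto_const]) (simp add: filterlim_at_infinity_conv_norm_at_top filterlim_real_sequentially)
  qed
  from tendsto_add[OF this Suc.IH] show ?case by simp
qed simp

text \<open>Each of the \<open>H\<close> shifts has asymptotically the same mean. The stride
  \<open>k\<close> is 1 in \<open>cesaro_sparse\<close> and the good gap \<open>h0\<close> in
  \<open>van_der_Corput\<close>.\<close>

lemma cesaro_window:
  fixes w :: "nat \<Rightarrow> 'a::real_normed_field"
  assumes bd: "\<And>n. norm (w n) \<le> C" and H: "H > 0"
  shows "(\<lambda>N. cesaro (\<lambda>n. (\<Sum>j<H. w (n + j * k)) / of_nat H) N - cesaro w N) \<longlonglongrightarrow> 0"
proof -
  have "(\<lambda>N. (\<Sum>j<H. cesaro (\<lambda>n. w (n + j * k)) N - cesaro w N) / of_nat H) \<longlonglongrightarrow> (\<Sum>j<H. 0) / of_nat H"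
    by (intro tendsto_intros cesaro_shift[OF bd]) (use H in auto)
  moreover have "(\<Sum>j<H. cesaro (\<lambda>n. w (n + j * k)) N - cesaro w N) / of_nat H =
      cesaro (\<lambda>n. (\<Sum>j<H. w (n + j * k)) / of_nat H) N - cesaro w N" for N
  proof -
    have "cesaro (\<lambda>n. (\<Sum>j<H. w (n + j * k)) / of_nat H) N = (\<Sum>j<H. cesaro (\<lambda>n. w (n + j * k)) N) / of_nat H"
      using cesaro_mult[of "1 / of_nat H" "\<lambda>n. \<Sum>j<H. w (n + j * k)" N] by (simp add: cesaro_sum)
    then show ?thesis using H by (simp add: sum_subtractf diff_divide_distrib)
  qed
  ultimately show ?thesis by simp
qed

text \<open>Averaging over windows of length \<open>K\<close> does not change the mean in the limit,
  and every window average is at most \<open>1 / K\<close>.\<close>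

lemma cesaro_sparse:
  fixes w :: "nat \<Rightarrow> real"
  assumes w: "\<And>n. 0 \<le> w n" "\<And>n. w n \<le> 1" and K: "K > 0"
    and win: "\<And>n. (\<Sum>j<K. w (n + j)) \<le> 1" and "\<epsilon> > 0"
  shows "\<forall>\<^sub>F N in sequentially. cesaro w N < 1 / real K + \<epsilon>"
proof -
  have "(\<lambda>N. cesaro (\<lambda>n. (\<Sum>j<K. w (n + j * 1)) / of_nat K) N - cesaro w N) \<longlonglongrightarrow> 0"
    by (rule cesaro_window[of _ 1]) (use w K in auto)
  then have "\<forall>\<^sub>F N in sequentially. dist (cesaro (\<lambda>n. (\<Sum>j<K. w (n + j * 1)) / of_nat K) N - cesaro w N) 0 < \<epsilon>"
    using \<open>\<epsilon> > 0\<close> by (rule tendstoD)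
  then show ?thesis
  proof (rule eventually_mono)
    fix N assume *: "dist (cesaro (\<lambda>n. (\<Sum>j<K. w (n + j * 1)) / of_nat K) N - cesaro w N) 0 < \<epsilon>"
    have "cesaro (\<lambda>n. (\<Sum>j<K. w (n + j * 1)) / of_nat K) N \<le> cesaro (\<lambda>n. 1 / real K) N"
      by (rule cesaro_mono) (use win in \<open>auto intro: divide_right_mono\<close>)
    also have "\<dots> \<le> 1 / real K" by (rule cesaro_const_le) simp
    finally show "cesaro w N < 1 / real K + \<epsilon>" using * by (simp add: dist_real_def)
  qed
qed

lemma cesaro_power2_le:
  fixes w :: "nat \<Rightarrow> real"
  shows "(cesaro w N)\<^sup>2 \<le> cesaro (\<lambda>n. (w n)\<^sup>2) N"
proof (cases "N = 0")
  case False
  have "(\<Sum>n<N. w n)\<^sup>2 \<le> (\<Sum>n<N. (w n)\<^sup>2) * card {..<N}"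
    by (rule sum_squared_le_sum_of_squares)
  then have "(\<Sum>n<N. w n)\<^sup>2 / (real N)\<^sup>2 \<le> (\<Sum>n<N. (w n)\<^sup>2) * real N / (real N)\<^sup>2"
    by (intro divide_right_mono) auto
  with False show ?thesis by (simp add: cesaro_def power_divide power2_eq_square)
qed (simp add: cesaro_def)

text \<open>The shifts are taken along multiples of a fixed good gap, so that every off-diagonal
  correlation vanishes.\<close>

lemma van_der_Corput:
  fixes u :: "nat \<Rightarrow> complex"
  assumes bd: "\<And>n. norm (u n) \<le> 1"
    and corr: "\<And>h. h \<ge> h0 \<Longrightarrow> cesaro (\<lambda>n. u (n + h) * cnj (u n)) \<longlonglongrightarrow> 0" and h0: "h0 > 0"
  shows "cesaro u \<longlonglongrightarrow> 0"
proof (rule tendsto_0I_eventually_norm_le)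
  fix \<epsilon> :: real assume e: "\<epsilon> > 0"
  have bd2: "norm (u (n + h) * cnj (u n)) \<le> 1" for n h
    using bd[of n] bd[of "n + h"] by (simp add: norm_mult mult_le_one)
  \<comment> \<open>The diagonal of the double sum below contributes at most \<open>1 / H\<close>,
    which this choice keeps below \<open>\<epsilon>\<^sup>2 / 8\<close>, half of the allowance
    \<open>(\<epsilon> / 2)\<^sup>2\<close>.\<close>
  obtain H :: nat where H0: "H > 0" and H: "real H > 8 / \<epsilon>\<^sup>2"
    by (meson reals_Archimedean2 less_le_trans gr0I not_less0 of_nat_0_less_iff order_less_trans
        zero_less_divide_iff zero_less_numeral zero_less_power e)
  define v where "v n = (\<Sum>j<H. u (n + j * h0)) / of_nat H" for n
  \<comment> \<open>Undoing the shift by \<open>j * h0\<close> leaves the correlation at lag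
    \<open>(i - j) * h0\<close>, which is at least \<open>h0\<close>.\<close>
  have off: "cesaro (\<lambda>n. u (n + i * h0) * cnj (u (n + j * h0))) \<longlonglongrightarrow> 0" if "j < i" for i j
  proof -
    let ?w = "\<lambda>n. u (n + (i - j) * h0) * cnj (u n)"
    have "(i - j) * h0 \<ge> h0" using that by (cases "i - j") auto
    from tendsto_add[OF cesaro_shift[of ?w 1 "j * h0", OF bd2] corr[OF this]]
    have "cesaro (\<lambda>n. ?w (n + j * h0)) \<longlonglongrightarrow> 0" by simp
    moreover have "n + j * h0 + (i - j) * h0 = n + i * h0" for n
      using that by (simp add: add_mult_distrib[symmetric])
    ultimately show ?thesis by simp
  qed
  have off': "cesaro (\<lambda>n. u (n + i * h0) * cnj (u (n + j * h0))) \<longlonglongrightarrow> 0" if "i \<noteq> j" for i j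
  proof (cases "j < i")
    case False
    with that have "i < j" by simp
    from tendsto_cnj[OF off[OF this]] show ?thesis
      by (simp add: cesaro_def[abs_def] mult.commute)
  qed (rule off)
  have sq: "complex_of_real (cesaro (\<lambda>n. (norm (v n))\<^sup>2) N) =
      (\<Sum>i<H. \<Sum>j<H. cesaro (\<lambda>n. u (n + i * h0) * cnj (u (n + j * h0))) N) / (of_nat H)\<^sup>2" for N
  proof -
    have "complex_of_real ((norm (v n))\<^sup>2) =
        (1 / (of_nat H)\<^sup>2) * (\<Sum>i<H. \<Sum>j<H. u (n + i * h0) * cnj (u (n + j * h0)))" for n
      unfolding complex_norm_square v_def
      by (simp add: sum_product power2_eq_square)
    then have "complex_of_real (cesaro (\<lambda>n. (norm (v n))\<^sup>2) N) =
      cesaro (\<lambda>n. (1 / (of_nat H)\<^sup>2) * (\<Sum>i<H. \<Sum>j<H. u (n + i * h0) * cnj (u (n + j * h0)))) N"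
      by (simp add: cesaro_def del: of_real_power)
    also have "\<dots> = (1 / (of_nat H)\<^sup>2) * (\<Sum>i<H. \<Sum>j<H. cesaro (\<lambda>n. u (n + i * h0) * cnj (u (n + j * h0))) N)"
      by (simp only: cesaro_mult cesaro_sum)
    finally show ?thesis by simp
  qed
  \<comment> \<open>The off-diagonal part of the expansion, a fixed finite combination of null
    sequences.\<close>
  define D where "D N = (\<Sum>i<H. \<Sum>j\<in>{..<H} - {i}. cesaro (\<lambda>n. u (n + i * h0) * cnj (u (n + j * h0))) N) / (of_nat H)\<^sup>2" for N
  have D: "D \<longlonglongrightarrow> 0"
  proof -
    have "D \<longlonglongrightarrow> (\<Sum>i<H. \<Sum>j\<in>{..<H} - {i}. 0) / (of_nat H)\<^sup>2"
      unfolding D_def by (intro tendsto_intros off') (use H0 in auto)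
    then show ?thesis by simp
  qed
  have sqle: "cesaro (\<lambda>n. (norm (v n))\<^sup>2) N \<le> norm (D N) + 1 / real H" for N
  proof -
    have "(\<Sum>i<H. \<Sum>j<H. cesaro (\<lambda>n. u (n + i * h0) * cnj (u (n + j * h0))) N) =
       (\<Sum>i<H. (\<Sum>j\<in>{..<H} - {i}. cesaro (\<lambda>n. u (n + i * h0) * cnj (u (n + j * h0))) N) +
           cesaro (\<lambda>n. u (n + i * h0) * cnj (u (n + i * h0))) N)"
      by (intro sum.cong refl) (simp add: sum.remove add.commute)
    then have eq: "complex_of_real (cesaro (\<lambda>n. (norm (v n))\<^sup>2) N) =
       D N + (\<Sum>i<H. cesaro (\<lambda>n. u (n + i * h0) * cnj (u (n + i * h0))) N) / (of_nat H)\<^sup>2"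
      unfolding sq D_def by (simp add: sum.distrib add_divide_distrib)
    have "norm (cesaro (\<lambda>n. u (n + i * h0) * cnj (u (n + i * h0))) N) \<le> 1" for i
    proof -
      have "norm (cesaro (\<lambda>n. u (n + i * h0) * cnj (u (n + i * h0))) N) \<le>
          cesaro (\<lambda>n. norm (u (n + i * h0) * cnj (u (n + i * h0)))) N" by (rule norm_cesaro_le)
      also have "\<dots> \<le> cesaro (\<lambda>n. 1) N"
        using bd by (intro cesaro_mono) (simp add: norm_mult mult_le_one)
      also have "\<dots> \<le> 1" by (rule cesaro_const_le) simp
      finally show ?thesis .
    qed
    then have "norm (\<Sum>i<H. cesaro (\<lambda>n. u (n + i * h0) * cnj (u (n + i * h0))) N) \<le> real H"
      using sum_norm_le[of "{..<H}" "\<lambda>i. cesaro (\<lambda>n. u (n + i * h0) * cnj (u (n + i * h0))) N" "\<lambda>i. 1"]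
      by simp
    then have "norm ((\<Sum>i<H. cesaro (\<lambda>n. u (n + i * h0) * cnj (u (n + i * h0))) N) / (of_nat H)\<^sup>2) \<le> real H / (real H)\<^sup>2"
      unfolding norm_divide by (simp add: norm_power divide_right_mono)
    also have "\<dots> = 1 / real H" using H0 by (simp add: power2_eq_square)
    finally have "norm (complex_of_real (cesaro (\<lambda>n. (norm (v n))\<^sup>2) N)) \<le> norm (D N) + 1 / real H"
      unfolding eq by (meson norm_triangle_le order_refl add_left_mono)
    then show ?thesis by simp
  qed
  have "\<forall>\<^sub>F N in sequentially. dist (D N) 0 < \<epsilon>\<^sup>2 / 8"
    using D by (rule tendstoD) (use e in auto)
  moreover have "\<forall>\<^sub>F N in sequentially. dist (cesaro v N - cesaro u N) 0 < \<epsilon> / 2"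
    unfolding v_def by (rule tendstoD[OF cesaro_window[OF bd H0]]) (use e in auto)
  ultimately show "\<forall>\<^sub>F N in sequentially. norm (cesaro u N) \<le> \<epsilon>"
  proof eventually_elim
    case (elim N)
    have "(norm (cesaro v N))\<^sup>2 \<le> (cesaro (\<lambda>n. norm (v n)) N)\<^sup>2"
      by (intro power_mono norm_cesaro_le) simp
    also have "\<dots> \<le> cesaro (\<lambda>n. (norm (v n))\<^sup>2) N" by (rule cesaro_power2_le)
    also have "\<dots> \<le> norm (D N) + 1 / real H" by (rule sqle)
    also have "\<dots> \<le> \<epsilon>\<^sup>2 / 8 + \<epsilon>\<^sup>2 / 8"
    proof (rule add_mono)
      show "norm (D N) \<le> \<epsilon>\<^sup>2 / 8" using elim(1) by simp
      show "1 / real H \<le> \<epsilon>\<^sup>2 / 8" using H H0 e by (simp add: field_simps)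
    qed
    also have "\<dots> = (\<epsilon> / 2)\<^sup>2" by (simp add: power2_eq_square)
    finally have "norm (cesaro v N) \<le> \<epsilon> / 2" by (rule power2_le_imp_le) (use e in simp)
    moreover have "norm (cesaro v N - cesaro u N) < \<epsilon> / 2" using elim(2) by simp
    ultimately show ?case
      using norm_triangle_ineq2[of "cesaro u N" "cesaro v N"] by (simp add: norm_minus_commute)
  qed
qed

text \<open>Shifting by \<open>q\<close> multiplies the mean by \<open>c\<close> but changes it only
  by a null sequence, so \<open>c - 1\<close> times the mean tends to 0.\<close>

lemma cesaro_quasi_periodic:
  fixes w :: "nat \<Rightarrow> complex"
  assumes bd: "\<And>n. norm (w n) \<le> C" and per: "\<And>n. w (n + q) = c * w n" and c: "c \<noteq> 1"
  shows "cesaro w \<longlonglongrightarrow> 0"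
proof -
  have "(\<lambda>N. cesaro (\<lambda>n. w (n + q)) N - cesaro w N) \<longlonglongrightarrow> 0" by (rule cesaro_shift[OF bd])
  then have "(\<lambda>N. (c - 1) * cesaro w N) \<longlonglongrightarrow> 0"
    unfolding per by (simp add: cesaro_mult algebra_simps)
  from tendsto_mult_left[OF this, of "inverse (c - 1)"] c show ?thesis by (simp add: mult.assoc[symmetric])
qed

subsection \<open>Weyl's theorem for polynomials\<close>

definition ec :: "real \<Rightarrow> complex" where
  "ec x = cis (2 * pi * x)"

lemma norm_ec [simp]: "norm (ec x) = 1"
  by (simp add: ec_def)

lemma ec_add: "ec (x + y) = ec x * ec y"
  by (simp add: ec_def cis_mult ring_distribs)

lemma ec_0 [simp]: "ec 0 = 1"
  by (simp add: ec_def)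

lemma cnj_ec: "cnj (ec x) = ec (- x)"
  by (simp add: ec_def cis_cnj)

lemma ec_Ints [simp]: "x \<in> \<int> \<Longrightarrow> ec x = 1"
  by (simp add: ec_def)

lemma ec_eq_1_iff: "ec x = 1 \<longleftrightarrow> x \<in> \<int>"
proof
  assume "ec x = 1"
  then have "cos (2 * pi * x) = 1" by (simp add: ec_def complex_eq_iff)
  then obtain n :: int where "2 * pi * x = of_int n * 2 * pi" by (auto simp: cos_one_2pi_int)
  then have "x = of_int n" by simp
  then show "x \<in> \<int>" by simp
qed simp

section \<open>Finite differences of polynomials\<close>

lemma coeff_pcompose_shift:
  fixes P :: "'a::comm_ring_1 poly"
  assumes "degree P \<le> n"
  shows "coeff (pcompose P [:h, 1:]) i =
    (\<Sum>k\<le>n. if i \<le> k then coeff P k * (of_nat (k choose i) * h ^ (k - i)) else 0)"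
proof -
  have *: "coeff ([:h, 1:] ^ k) i = (if i \<le> k then of_nat (k choose i) * h ^ (k - i) else 0)" for k
  proof (cases "i \<le> k")
    case False
    then have "degree ([:h, 1:] ^ k) < i" using degree_linear_power[of h k] by simp
    with False show ?thesis by (simp add: coeff_eq_0)
  qed (simp add: coeff_linear_poly_power)
  have "pcompose P [:h, 1:] = (\<Sum>k\<le>degree P. smult (coeff P k) ([:h, 1:] ^ k))"
  proof (cases "P = 0")
    case False
    have "degree (map_poly (\<lambda>x. [:x:]) P) = degree P" by (rule degree_map_poly) auto
    then show ?thesis unfolding pcompose_altdef poly_altdef by (simp add: coeff_map_poly)
  qed simp
  also have "\<dots> = (\<Sum>k\<le>n. smult (coeff P k) ([:h, 1:] ^ k))"
    using assms by (intro sum.mono_neutral_left) (auto simp: coeff_eq_0 not_le)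
  finally show ?thesis by (simp add: coeff_sum * if_distrib cong: if_cong)
qed

definition diff_poly :: "'a::comm_ring_1 \<Rightarrow> 'a poly \<Rightarrow> 'a poly" where
  "diff_poly h P = pcompose P [:h, 1:] - P"

lemma poly_diff_poly: "poly (diff_poly h P) x = poly P (x + h) - poly P x"
  by (simp add: diff_poly_def poly_pcompose add.commute)

text \<open>Only coefficients of \<open>P\<close> of index at least \<open>j - 1\<close> reach
  degree \<open>j - 1\<close>. The one at \<open>j - 1\<close> cancels against \<open>P\<close>, the
  one at \<open>j\<close> gives the subtracted term, and all higher ones enter with rational
  factors.\<close>

lemma coeff_diff_poly_Rats:
  fixes P :: "real poly"
  assumes j: "j \<ge> 1" and rat: "\<And>k. k > j \<Longrightarrow> coeff P k \<in> \<rat>" and h: "h \<in> \<rat>"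
  shows "coeff (diff_poly h P) (j - 1) - real j * h * coeff P j \<in> \<rat>"
proof -
  \<comment> \<open>The range is padded so that \<open>j\<close> lies in it even beyond the degree;
    both corrections can then be written as sums over the same range.\<close>
  define n where "n = max (degree P) j"
  define f where "f k = (if j - 1 \<le> k then coeff P k * (of_nat (k choose (j - 1)) * h ^ (k - (j - 1))) else 0)" for k
  have "coeff (diff_poly h P) (j - 1) - real j * h * coeff P j =
     (\<Sum>k\<le>n. f k) - (\<Sum>k\<le>n. if k = j - 1 then coeff P k else 0) - (\<Sum>k\<le>n. if k = j then real j * h * coeff P k else 0)"
    unfolding diff_poly_def coeff_diff f_def
    by (subst coeff_pcompose_shift[of P n]) (auto simp: n_def)
  also have "\<dots> = (\<Sum>k\<le>n. f k - (if k = j - 1 then coeff P k else 0) - (if k = j then real j * h * coeff P k else 0))"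
    by (simp add: sum_subtractf)
  also have "\<dots> \<in> \<rat>"
  proof (rule Rats_sum)
    fix k
    consider "k < j - 1" | "k = j - 1" | "k = j" | "k > j" by linarith
    then show "f k - (if k = j - 1 then coeff P k else 0) - (if k = j then real j * h * coeff P k else 0) \<in> \<rat>"
    proof cases
      case 3
      then obtain i where "k = Suc i" "j = Suc i" using j by (cases k) auto
      then show ?thesis by (simp add: f_def)
    next
      case 4
      then show ?thesis using rat[of k] h by (auto simp: f_def intro!: Rats_mult Rats_power)
    qed (use j in \<open>auto simp: f_def\<close>)
  qed
  finally show ?thesis .
qed

section \<open>Rationality and common denominators\<close>

lemma Rats_add_cancel: "x \<in> \<rat> \<Longrightarrow> y - x \<in> \<rat> \<longleftrightarrow> (y::real) \<in> \<rat>"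
  by (metis Rats_add Rats_diff diff_add_cancel)

lemma Rats_mult_cancel: "q \<in> \<rat> \<Longrightarrow> q \<noteq> 0 \<Longrightarrow> q * x \<in> \<rat> \<longleftrightarrow> (x::real) \<in> \<rat>"
  using Rats_divide[of "q * x" q] by (auto intro: Rats_mult)

lemma Rats_common_denominator:
  assumes "finite A" "\<And>k. k \<in> A \<Longrightarrow> f k \<in> (\<rat> :: real set)"
  shows "\<exists>q::nat. q > 0 \<and> (\<forall>k\<in>A. real q * f k \<in> \<int>)"
  using assms
proof (induction rule: finite_induct)
  case (insert a A)
  then obtain q where q: "q > 0" "\<And>k. k \<in> A \<Longrightarrow> real q * f k \<in> \<int>" by auto
  have "f a \<in> \<rat>" using insert by auto
  then obtain c d where "d > 0" "f a = of_int c / of_int d" by (auto elim: Rats_cases')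
  then have d: "nat d > 0" "real (nat d) * f a = of_int c" by auto
  have "real (nat d * q) * f k \<in> \<int>" if "k \<in> insert a A" for k
  proof (cases "k = a")
    case True
    have "real (nat d * q) * f k = real q * (real (nat d) * f a)" using True by simp
    also have "\<dots> = real q * of_int c" by (simp only: d(2))
    finally have "real (nat d * q) * f k = real q * of_int c" .
    then show ?thesis by (metis Ints_mult Ints_of_int Ints_of_nat)
  next
    case False
    then have "real q * f k \<in> \<int>" using q(2) that by blast
    from Ints_mult[OF Ints_of_nat[of "nat d"] this] show ?thesis by (simp only: of_nat_mult mult.assoc)
  qed
  then show ?case using d q by (intro exI[of _ "nat d * q"]) auto
qed auto

text \<open>Only finitely many coefficients are nonzero, so a last irrational one exists. Its index,
  and not the degree, drives the induction in \<open>weyl_equidistribution\<close>.\<close>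

lemma top_irrational_coeff:
  fixes P :: "real poly"
  assumes "coeff P j \<notin> \<rat>"
  obtains M where "M \<ge> j" "coeff P M \<notin> \<rat>" "\<And>k. k > M \<Longrightarrow> coeff P k \<in> \<rat>"
proof -
  define I where "I = {k. coeff P k \<notin> \<rat>}"
  have fin: "finite I"
    unfolding I_def by (rule finite_subset[of _ "{..degree P}"]) (auto intro!: le_degree)
  have "j \<in> I" using assms by (simp add: I_def)
  show thesis
  proof (rule that)
    show "Max I \<ge> j" using fin \<open>j \<in> I\<close> by simp
    show "coeff P (Max I) \<notin> \<rat>" using Max_in[OF fin] \<open>j \<in> I\<close> by (auto simp: I_def)
    show "coeff P k \<in> \<rat>" if "k > Max I" for k
      using Max_ge[OF fin, of k] that by (force simp: I_def)
  qed
qed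

text \<open>With \<open>q\<close> a common denominator of the coefficients of index above 1, a step
  of \<open>q\<close> changes the value by \<open>q * coeff R 1\<close> modulo 1. The sequence is
  thus quasi-periodic, with a factor that irrationality keeps different from 1.\<close>

lemma weyl_linear:
  fixes R :: "real poly"
  assumes irr: "coeff R 1 \<notin> \<rat>" and rat: "\<And>k. k > 1 \<Longrightarrow> coeff R k \<in> \<rat>"
  shows "cesaro (\<lambda>n. ec (poly R (real n))) \<longlonglongrightarrow> 0"
proof -
  obtain q :: nat where q: "q > 0" "\<And>k. k \<in> {2..degree R} \<Longrightarrow> real q * coeff R k \<in> \<int>"
    using Rats_common_denominator[of "{2..degree R}" "coeff R"] rat by auto
  have *: "real q * coeff R k \<in> \<int>" if "k > 1" for k
    using q(2)[of k] that by (cases "k \<le> degree R") (auto simp: coeff_eq_0)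
  have diff: "poly R (real (n + q)) - poly R (real n) - real q * coeff R 1 \<in> \<int>" for n
  proof -
    have "poly R x = (\<Sum>k\<le>max 1 (degree R). coeff R k * x ^ k)" for x
      unfolding poly_altdef by (intro sum.mono_neutral_left) (auto simp: coeff_eq_0 not_le)
    then have "poly R (real (n + q)) - poly R (real n) =
       (\<Sum>k\<le>max 1 (degree R). coeff R k * (real (n + q) ^ k - real n ^ k))"
      by (simp only: sum_subtractf right_diff_distrib)
    also have "\<dots> - real q * coeff R 1 =
       (\<Sum>k\<le>max 1 (degree R). coeff R k * (real (n + q) ^ k - real n ^ k) - (if k = 1 then real q * coeff R 1 else 0))"
      by (simp add: sum_subtractf)
    also have "\<dots> \<in> \<int>"
    proof (rule Ints_sum)
      fix k :: nat
      consider "k = 0" | "k = 1" | "k > 1" by linarith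
      then show "coeff R k * (real (n + q) ^ k - real n ^ k) - (if k = 1 then real q * coeff R 1 else 0) \<in> \<int>"
      proof cases
        case 3
        \<comment> \<open>The factor \<open>q\<close> of the difference of powers clears the
          denominator of \<open>coeff R k\<close>.\<close>
        have "int q dvd (int n + int q) ^ k - int n ^ k"
          using power_diff_sumr2[of "int n + int q" k "int n"] by simp
        then obtain c where c: "(int n + int q) ^ k - int n ^ k = int q * c" by auto
        have "real (n + q) ^ k - real n ^ k = of_int ((int n + int q) ^ k - int n ^ k)" by simp
        also have "\<dots> = real q * of_int c" by (simp add: c)
        finally have eq: "coeff R k * (real (n + q) ^ k - real n ^ k) = (real q * coeff R k) * of_int c"
          by simp
        show ?thesis unfolding eq using 3 Ints_mult[OF *[OF 3] Ints_of_int[of c]] by simp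
      qed (auto simp: algebra_simps)
    qed
    finally show ?thesis .
  qed
  show ?thesis
  proof (rule cesaro_quasi_periodic[of _ 1 q "ec (real q * coeff R 1)"])
    fix n
    have "ec (poly R (real (n + q))) =
       ec (poly R (real (n + q)) - poly R (real n) - real q * coeff R 1 + (real q * coeff R 1 + poly R (real n)))"
      by simp
    also have "\<dots> = ec (real q * coeff R 1) * ec (poly R (real n))"
      unfolding ec_add using diff[of n] by simp
    finally show "ec (poly R (real (n + q))) = ec (real q * coeff R 1) * ec (poly R (real n))" .
  next
    show "ec (real q * coeff R 1) \<noteq> 1"
    proof
      assume "ec (real q * coeff R 1) = 1"
      then have "real q * coeff R 1 \<in> \<rat>" using ec_eq_1_iff Ints_subset_Rats by blast
      then have "real q * coeff R 1 / real q \<in> \<rat>" by (intro Rats_divide) auto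
      then show False using q irr by simp
    qed
  qed simp
qed

text \<open>Differencing lowers the index of the last irrational coefficient by one, so van der
  Corput's inequality reduces the claim to \<open>weyl_linear\<close>.\<close>

theorem weyl_equidistribution:
  fixes R :: "real poly"
  assumes "j \<ge> 1" "coeff R j \<notin> \<rat>"
  shows "cesaro (\<lambda>n. ec (poly R (real n))) \<longlonglongrightarrow> 0"
proof -
  have top: "cesaro (\<lambda>n. ec (poly R (real n))) \<longlonglongrightarrow> 0"
    if "coeff R (Suc i) \<notin> \<rat>" "\<And>k. k > Suc i \<Longrightarrow> coeff R k \<in> \<rat>" for i R
    using that
  proof (induction i arbitrary: R)
    case 0
    then show ?case using weyl_linear[of R] by simp
  next
    case (Suc i)
    show ?case
    proof (rule van_der_Corput[of _ 1])
      fix h :: nat assume h: "h \<ge> 1"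
      let ?D = "diff_poly (real h) R"
      have "cesaro (\<lambda>n. ec (poly ?D (real n))) \<longlonglongrightarrow> 0"
      proof (rule Suc.IH)
        have *: "coeff ?D (Suc i) - real (Suc (Suc i)) * real h * coeff R (Suc (Suc i)) \<in> \<rat>"
          using coeff_diff_poly_Rats[of "Suc (Suc i)" R "real h"] Suc.prems by simp
        show "coeff ?D (Suc i) \<notin> \<rat>"
        proof
          assume "coeff ?D (Suc i) \<in> \<rat>"
          with Rats_diff[OF this *] have "(real (Suc (Suc i)) * real h) * coeff R (Suc (Suc i)) \<in> \<rat>" by simp
          moreover have "(real (Suc (Suc i)) * real h) \<in> \<rat>" "(real (Suc (Suc i)) * real h) \<noteq> 0"
            using h by (auto simp del: of_nat_Suc)
          ultimately show False using Rats_mult_cancel Suc.prems(1) by blast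
        qed
        fix k assume k: "k > Suc i"
        then have "coeff ?D k - real (Suc k) * real h * coeff R (Suc k) \<in> \<rat>"
          using coeff_diff_poly_Rats[of "Suc k" R "real h"] Suc.prems by simp
        moreover have "real (Suc k) * real h * coeff R (Suc k) \<in> \<rat>"
          using Suc.prems(2)[of "Suc k"] k by (intro Rats_mult) auto
        ultimately show "coeff ?D k \<in> \<rat>" using Rats_add_cancel by blast
      qed
      moreover have "ec (poly R (real (n + h))) * cnj (ec (poly R (real n))) = ec (poly ?D (real n))" for n
        by (simp add: poly_diff_poly cnj_ec ec_add[symmetric])
      ultimately show "cesaro (\<lambda>n. ec (poly R (real (n + h))) * cnj (ec (poly R (real n)))) \<longlonglongrightarrow> 0"
        by simp
    qed auto
  qed
  obtain M where M: "M \<ge> j" "coeff R M \<notin> \<rat>" "\<And>k. k > M \<Longrightarrow> coeff R k \<in> \<rat>"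
    using top_irrational_coeff[OF assms(2)] by blast
  then show ?thesis using top[of R "M - 1"] \<open>j \<ge> 1\<close> by simp
qed

subsection \<open>Besicovitch approximation by trigonometric polynomials\<close>

text \<open>Trigonometric polynomials. The parameter \<open>F\<close> tracks their frequencies,
  because Weyl's theorem is applied one frequency at a time and depends on which numbers
  occur.\<close>

inductive trig :: "real set \<Rightarrow> (real \<Rightarrow> complex) \<Rightarrow> bool" for F where
  zero: "trig F (\<lambda>x. 0)"
| cons: "g \<in> F \<Longrightarrow> trig F T \<Longrightarrow> trig F (\<lambda>x. c * ec (g * x) + T x)"

lemma trig_monom: "g \<in> F \<Longrightarrow> trig F (\<lambda>x. c * ec (g * x))"
  using trig.cons[OF _ trig.zero, of g F c] by simp

lemma trig_add: "trig F S \<Longrightarrow> trig F T \<Longrightarrow> trig F (\<lambda>x. S x + T x)"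
  by (induction rule: trig.induct) (auto simp: add.assoc intro: trig.cons)

lemma trig_monom_mult:
  assumes "trig F T" "\<And>f. f \<in> F \<Longrightarrow> g + f \<in> K"
  shows "trig K (\<lambda>x. c * ec (g * x) * T x)"
  using assms
proof (induction rule: trig.induct)
  case (cons f T d)
  have "trig K (\<lambda>x. (c * d) * ec ((g + f) * x) + c * ec (g * x) * T x)"
    using cons by (intro trig.cons) auto
  then show ?case by (simp add: ring_distribs ec_add mult_ac)
qed (simp add: trig.zero)

lemma trig_mult:
  assumes "trig F S" "trig G T" "\<And>f g. f \<in> F \<Longrightarrow> g \<in> G \<Longrightarrow> f + g \<in> K"
  shows "trig K (\<lambda>x. S x * T x)"
  using assms
proof (induction rule: trig.induct)
  case (cons g S c)
  then show ?case by (simp add: distrib_right trig_add trig_monom_mult)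
qed (simp add: trig.zero)

lemma trig_mono: "trig F T \<Longrightarrow> F \<subseteq> G \<Longrightarrow> trig G T"
  by (induction rule: trig.induct) (auto intro: trig.intros)

lemma trig_shift: "trig F T \<Longrightarrow> trig F (\<lambda>x. T (x + h))"
proof (induction rule: trig.induct)
  case (cons g T c)
  then have "trig F (\<lambda>x. (c * ec (g * h)) * ec (g * x) + T (x + h))" by (intro trig.cons)
  then show ?case by (simp add: ring_distribs ec_add mult_ac)
qed (rule trig.zero)

lemma trig_scale:
  assumes "trig F T" "\<And>f. f \<in> F \<Longrightarrow> f * b \<in> G"
  shows "trig G (\<lambda>x. T (b * x))"
  using assms
proof (induction rule: trig.induct)
  case (cons g T c)
  then have "trig G (\<lambda>x. c * ec ((g * b) * x) + T (b * x))" by (intro trig.cons) auto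
  then show ?case by (simp add: mult_ac)
qed (rule trig.zero)

lemma trig_bounded: "trig F T \<Longrightarrow> \<exists>C. \<forall>x. norm (T x) \<le> C"
proof (induction rule: trig.induct)
  case (cons g T c)
  then obtain C where C: "\<And>x. norm (T x) \<le> C" by auto
  have "norm (c * ec (g * x) + T x) \<le> norm c + C" for x
    using norm_triangle_ineq[of "c * ec (g * x)" "T x"] C[of x] by (simp add: norm_mult)
  then show ?case by blast
qed auto

text \<open>Bounded almost periodic sequences in the sense of Besicovitch, approximated from
  frequencies in \<open>F\<close>. Approximation in mean tolerates the jumps of the fractional part;
  boundedness makes products manageable.\<close>

definition besicovitch :: "real set \<Rightarrow> (nat \<Rightarrow> complex) \<Rightarrow> bool" where
  "besicovitch F b \<longleftrightarrow> (\<exists>C. \<forall>n. norm (b n) \<le> C) \<and>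
     (\<forall>\<epsilon>>0. \<exists>T. trig F T \<and> (\<forall>\<^sub>F N in sequentially. cesaro (\<lambda>n. norm (b n - T (real n))) N < \<epsilon>))"

lemma besicovitch_trig: "trig F T \<Longrightarrow> besicovitch F (\<lambda>n. T (real n))"
  unfolding besicovitch_def using trig_bounded[of F T]
  by (auto intro!: exI[of _ T] simp: cesaro_def)

lemma besicovitch_mono: "besicovitch F b \<Longrightarrow> F \<subseteq> G \<Longrightarrow> besicovitch G b"
  unfolding besicovitch_def by (meson trig_mono)

lemma besicovitch_add:
  assumes "besicovitch F a" "besicovitch F b"
  shows "besicovitch F (\<lambda>n. a n + b n)"
  unfolding besicovitch_def
proof (intro conjI allI impI)
  obtain A B where "\<And>n. norm (a n) \<le> A" "\<And>n. norm (b n) \<le> B"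
    using assms unfolding besicovitch_def by meson
  then have "norm (a n + b n) \<le> A + B" for n
    by (meson add_mono norm_triangle_le)
  then show "\<exists>C. \<forall>n. norm (a n + b n) \<le> C" by blast
  fix \<epsilon> :: real assume "\<epsilon> > 0"
  then have "\<epsilon> / 2 > 0" by simp
  then obtain S T where S: "trig F S" "\<forall>\<^sub>F N in sequentially. cesaro (\<lambda>n. norm (a n - S (real n))) N < \<epsilon> / 2"
    and T: "trig F T" "\<forall>\<^sub>F N in sequentially. cesaro (\<lambda>n. norm (b n - T (real n))) N < \<epsilon> / 2"
    using assms unfolding besicovitch_def by meson
  from S(2) T(2) have "\<forall>\<^sub>F N in sequentially. cesaro (\<lambda>n. norm (a n + b n - (S (real n) + T (real n)))) N < \<epsilon>"
  proof eventually_elim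
    case (elim N)
    have "cesaro (\<lambda>n. norm (a n + b n - (S (real n) + T (real n)))) N \<le>
        cesaro (\<lambda>n. norm (a n - S (real n)) + norm (b n - T (real n))) N"
      by (rule cesaro_mono) (simp add: norm_diff_triangle_ineq)
    with elim show ?case by (simp add: cesaro_add)
  qed
  then show "\<exists>T. trig F T \<and> (\<forall>\<^sub>F N in sequentially. cesaro (\<lambda>n. norm (a n + b n - T (real n))) N < \<epsilon>)"
    using trig_add[OF S(1) T(1)] by blast
qed

text \<open>Rests on \<open>a b - S T = a (b - T) + T (a - S)\<close>. The approximant
  \<open>T\<close> is chosen first, since the precision required of \<open>S\<close> depends on the
  bound of \<open>T\<close>. The added 1 keeps the denominators positive when a bound is 0.\<close>

lemma besicovitch_mult:
  assumes "besicovitch F a" "besicovitch G b" "\<And>f g. f \<in> F \<Longrightarrow> g \<in> G \<Longrightarrow> f + g \<in> K"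
  shows "besicovitch K (\<lambda>n. a n * b n)"
  unfolding besicovitch_def
proof (intro conjI allI impI)
  obtain A B where A: "\<And>n. norm (a n) \<le> A" and B: "\<And>n. norm (b n) \<le> B"
    using assms unfolding besicovitch_def by meson
  have A0: "A \<ge> 0" using A[of 0] norm_ge_zero order_trans by blast
  have "norm (a n * b n) \<le> A * B" for n
    using A[of n] B[of n] A0 by (simp add: norm_mult mult_mono)
  then show "\<exists>C. \<forall>n. norm (a n * b n) \<le> C" by blast
  have half: "x * (y / (2 * x)) = y / 2" if "x > 0" for x y :: real
    using that by simp
  fix \<epsilon> :: real assume e: "\<epsilon> > 0"
  then have "\<epsilon> / (2 * (A + 1)) > 0" using A0 by simp
  then obtain T where T: "trig G T"
      "\<forall>\<^sub>F N in sequentially. cesaro (\<lambda>n. norm (b n - T (real n))) N < \<epsilon> / (2 * (A + 1))"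
    using assms(2) unfolding besicovitch_def by meson
  obtain C where C: "\<And>x. norm (T x) \<le> C" using trig_bounded[OF T(1)] by auto
  have C0: "C \<ge> 0" using C[of 0] norm_ge_zero order_trans by blast
  then have "\<epsilon> / (2 * (C + 1)) > 0" using e by simp
  then obtain S where S: "trig F S"
      "\<forall>\<^sub>F N in sequentially. cesaro (\<lambda>n. norm (a n - S (real n))) N < \<epsilon> / (2 * (C + 1))"
    using assms(1) unfolding besicovitch_def by meson
  from S(2) T(2) have "\<forall>\<^sub>F N in sequentially. cesaro (\<lambda>n. norm (a n * b n - S (real n) * T (real n))) N < \<epsilon>"
  proof eventually_elim
    case (elim N)
    have "cesaro (\<lambda>n. norm (a n * b n - S (real n) * T (real n))) N \<le>
        cesaro (\<lambda>n. (A + 1) * norm (b n - T (real n)) + (C + 1) * norm (a n - S (real n))) N"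
    proof (rule cesaro_mono)
      fix n
      have "a n * b n - S (real n) * T (real n) = a n * (b n - T (real n)) + T (real n) * (a n - S (real n))"
        by (simp add: algebra_simps)
      also have "norm \<dots> \<le> norm (a n) * norm (b n - T (real n)) + norm (T (real n)) * norm (a n - S (real n))"
        by (metis norm_mult norm_triangle_ineq)
      also have "\<dots> \<le> (A + 1) * norm (b n - T (real n)) + (C + 1) * norm (a n - S (real n))"
        using A[of n] C[of "real n"] by (intro add_mono mult_right_mono) auto
      finally show "norm (a n * b n - S (real n) * T (real n)) \<le>
         (A + 1) * norm (b n - T (real n)) + (C + 1) * norm (a n - S (real n))" .
    qed
    also have "\<dots> = (A + 1) * cesaro (\<lambda>n. norm (b n - T (real n))) N + (C + 1) * cesaro (\<lambda>n. norm (a n - S (real n))) N"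
      by (simp add: cesaro_add cesaro_mult)
    also have "\<dots> < (A + 1) * (\<epsilon> / (2 * (A + 1))) + (C + 1) * (\<epsilon> / (2 * (C + 1)))"
      using elim A0 C0 by (intro add_strict_mono mult_strict_left_mono) auto
    also have "(A + 1) * (\<epsilon> / (2 * (A + 1))) = \<epsilon> / 2" by (rule half) (use A0 in simp)
    also have "(C + 1) * (\<epsilon> / (2 * (C + 1))) = \<epsilon> / 2" by (rule half) (use C0 in simp)
    also have "\<epsilon> / 2 + \<epsilon> / 2 = \<epsilon>" by simp
    finally show ?case .
  qed
  then show "\<exists>T. trig K T \<and> (\<forall>\<^sub>F N in sequentially. cesaro (\<lambda>n. norm (a n * b n - T (real n))) N < \<epsilon>)"
    using trig_mult[OF S(1) T(1) assms(3)] by blast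
qed

lemma besicovitch_monom: "g \<in> F \<Longrightarrow> besicovitch F (\<lambda>n. c * ec (g * real n))"
  by (intro besicovitch_trig[of F "\<lambda>x. c * ec (g * x)"] trig_monom)

lemma besicovitch_const: "0 \<in> F \<Longrightarrow> besicovitch F (\<lambda>n. c)"
  using besicovitch_monom[of 0 F c] by simp

lemma besicovitch_cmult: "besicovitch F b \<Longrightarrow> besicovitch F (\<lambda>n. c * b n)"
  by (rule besicovitch_mult[OF besicovitch_const[of "{0}"]]) auto

lemma besicovitch_prod:
  assumes "finite I" "\<And>i. i \<in> I \<Longrightarrow> besicovitch (F i) (b i)"
  shows "besicovitch {\<Sum>i\<in>I. f i |f. \<forall>i\<in>I. f i \<in> F i} (\<lambda>n. \<Prod>i\<in>I. b i n)"
  using assms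
proof (induction rule: finite_induct)
  case empty
  then show ?case by (simp add: besicovitch_const)
next
  case (insert i I)
  have "besicovitch {\<Sum>i\<in>insert i I. f i |f. \<forall>i\<in>insert i I. f i \<in> F i} (\<lambda>n. b i n * (\<Prod>i\<in>I. b i n))"
  proof (rule besicovitch_mult)
    show "besicovitch (F i) (b i)" using insert by simp
    show "besicovitch {\<Sum>i\<in>I. f i |f. \<forall>i\<in>I. f i \<in> F i} (\<lambda>n. \<Prod>i\<in>I. b i n)"
      using insert by simp
    fix x y assume x: "x \<in> F i" and "y \<in> {\<Sum>i\<in>I. f i |f. \<forall>i\<in>I. f i \<in> F i}"
    then obtain f where f: "y = (\<Sum>i\<in>I. f i)" "\<forall>i\<in>I. f i \<in> F i" by auto
    have "x + y = (\<Sum>j\<in>insert i I. (f(i := x)) j)"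
      using insert f by (auto intro!: sum.cong)
    moreover have "\<forall>j\<in>insert i I. (f(i := x)) j \<in> F j" using f x by auto
    ultimately show "x + y \<in> {\<Sum>i\<in>insert i I. f i |f. \<forall>i\<in>insert i I. f i \<in> F i}" by blast
  qed
  then show ?case using insert by simp
qed

text \<open>A shift only multiplies the coefficients of the approximant by constants, and the mean
  of the bounded error is asymptotically shift invariant.\<close>

lemma besicovitch_shift:
  assumes "besicovitch F b"
  shows "besicovitch F (\<lambda>n. b (n + h))"
  unfolding besicovitch_def
proof (intro conjI allI impI)
  obtain B where B: "\<And>n. norm (b n) \<le> B" using assms unfolding besicovitch_def by meson
  then show "\<exists>C. \<forall>n. norm (b (n + h)) \<le> C" by blast
  fix \<epsilon> :: real assume "\<epsilon> > 0"
  then have e: "\<epsilon> / 2 > 0" by simp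
  then obtain T where T: "trig F T" "\<forall>\<^sub>F N in sequentially. cesaro (\<lambda>n. norm (b n - T (real n))) N < \<epsilon> / 2"
    using assms unfolding besicovitch_def by meson
  obtain C where C: "\<And>x. norm (T x) \<le> C" using trig_bounded[OF T(1)] by auto
  have "norm (norm (b n - T (real n))) \<le> B + C" for n
    using norm_triangle_ineq4[of "b n" "T (real n)"] B[of n] C[of "real n"] by simp
  from tendstoD[OF cesaro_shift[of "\<lambda>n. norm (b n - T (real n))" _ h, OF this] e] T(2)
  have "\<forall>\<^sub>F N in sequentially. cesaro (\<lambda>n. norm (b (n + h) - T (real (n + h)))) N < \<epsilon>"
  proof eventually_elim
    case (elim N)
    then show ?case unfolding dist_real_def by linarith
  qed
  then show "\<exists>T. trig F T \<and> (\<forall>\<^sub>F N in sequentially. cesaro (\<lambda>n. norm (b (n + h) - T (real n))) N < \<epsilon>)"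
    using trig_shift[OF T(1), of "real h"] by (intro exI[of _ "\<lambda>x. T (x + real h)"]) simp
qed

text \<open>Reduces a mean weighted by \<open>b\<close> to one mean per frequency: the approximant
  gives a finite combination of null sequences, and replacing \<open>b\<close> costs little because
  \<open>w\<close> is bounded.\<close>

lemma besicovitch_cesaro_tendsto_0:
  assumes b: "besicovitch F b" and w: "\<And>n. norm (w n) \<le> 1"
    and F: "\<And>g. g \<in> F \<Longrightarrow> cesaro (\<lambda>n. ec (g * real n) * w n) \<longlonglongrightarrow> 0"
  shows "cesaro (\<lambda>n. b n * w n) \<longlonglongrightarrow> 0"
proof (rule tendsto_0I_eventually_norm_le)
  fix \<epsilon> :: real assume "\<epsilon> > 0"
  then have e: "\<epsilon> / 2 > 0" by simp
  then obtain T where T: "trig F T" "\<forall>\<^sub>F N in sequentially. cesaro (\<lambda>n. norm (b n - T (real n))) N < \<epsilon> / 2"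
    using b unfolding besicovitch_def by meson
  from T(1) have "cesaro (\<lambda>n. T (real n) * w n) \<longlonglongrightarrow> 0"
  proof (induction rule: trig.induct)
    case (cons g T c)
    have "(\<lambda>N. c * cesaro (\<lambda>n. ec (g * real n) * w n) N + cesaro (\<lambda>n. T (real n) * w n) N) \<longlonglongrightarrow> c * 0 + 0"
      using cons F by (intro tendsto_intros) auto
    then show ?case by (simp add: cesaro_mult[symmetric] cesaro_add[symmetric] distrib_right mult.assoc)
  qed (simp add: cesaro_def[abs_def])
  from tendstoD[OF this e] T(2) show "\<forall>\<^sub>F N in sequentially. norm (cesaro (\<lambda>n. b n * w n) N) \<le> \<epsilon>"
  proof eventually_elim
    case (elim N)
    have "norm (cesaro (\<lambda>n. (b n - T (real n)) * w n) N) \<le> cesaro (\<lambda>n. norm ((b n - T (real n)) * w n)) N"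
      by (rule norm_cesaro_le)
    also have "\<dots> \<le> cesaro (\<lambda>n. norm (b n - T (real n))) N"
      using w by (intro cesaro_mono) (simp add: norm_mult mult_left_le)
    finally have "norm (cesaro (\<lambda>n. (b n - T (real n)) * w n) N) < \<epsilon> / 2" using elim by simp
    moreover have "cesaro (\<lambda>n. b n * w n) N = cesaro (\<lambda>n. (b n - T (real n)) * w n) N + cesaro (\<lambda>n. T (real n) * w n) N"
      by (simp add: cesaro_add[symmetric] algebra_simps)
    ultimately show ?case
      using elim(1) norm_triangle_ineq[of "cesaro (\<lambda>n. (b n - T (real n)) * w n) N" "cesaro (\<lambda>n. T (real n) * w n) N"]
      by simp
  qed
qed

section \<open>Weierstrass approximation on the circle\<close>

lemma bounded_linear_complex_trig:
  assumes "bounded_linear (g :: complex \<Rightarrow> real)"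
  shows "trig \<int> (\<lambda>x. complex_of_real (g (ec x)))"
proof -
  interpret bounded_linear g by fact
  have "complex_of_real (g (ec x)) =
      (of_real (g 1) / 2 + of_real (g \<i>) / (2 * \<i>)) * ec (1 * x) +
      (of_real (g 1) / 2 - of_real (g \<i>) / (2 * \<i>)) * ec ((- 1) * x)" for x
  proof -
    \<comment> \<open>A real-linear functional is a combination of \<open>z\<close> and its
      conjugate, and conjugation turns the frequency 1 of \<open>ec x\<close> into -1.\<close>
    have "ec x = Re (ec x) *\<^sub>R 1 + Im (ec x) *\<^sub>R \<i>" by (simp add: complex_eq_iff)
    then have "g (ec x) = Re (ec x) * g 1 + Im (ec x) * g \<i>" by (metis add scaleR real_scaleR_def)
    moreover have "ec (-x) = cnj (ec x)" by (simp add: cnj_ec)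
    ultimately show ?thesis by (simp add: complex_eq_iff field_simps)
  qed
  moreover have "trig \<int> (\<lambda>x. (of_real (g 1) / 2 + of_real (g \<i>) / (2 * \<i>)) * ec (1 * x) +
      (of_real (g 1) / 2 - of_real (g \<i>) / (2 * \<i>)) * ec ((- 1) * x))"
    by (intro trig_add trig_monom) auto
  ultimately show ?thesis by simp
qed

lemma circle_trig_approx:
  fixes f :: "complex \<Rightarrow> complex"
  assumes f: "continuous_on (sphere 0 1) f" and e: "\<epsilon> > 0"
  obtains T where "trig \<int> T" "\<And>x. norm (f (ec x) - T x) < \<epsilon>"
proof -
  \<comment> \<open>Stone-Weierstrass supplies polynomials in the real and imaginary parts; they
    stay trigonometric because integer frequencies are closed under addition.\<close>
  have rpf: "trig \<int> (\<lambda>x. complex_of_real (g (ec x)))" if "real_polynomial_function g" for g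
    using that
  proof (induction rule: real_polynomial_function.induct)
    case (const c)
    show ?case using trig_monom[of 0 \<int> "of_real c"] by simp
  qed (auto simp: bounded_linear_complex_trig intro: trig_add intro!: trig_mult)
  obtain g where g: "polynomial_function g" "\<And>z. z \<in> sphere 0 1 \<Longrightarrow> norm (f z - g z) < \<epsilon>"
    using Stone_Weierstrass_polynomial_function[OF compact_sphere f e] by auto
  have "real_polynomial_function (\<lambda>z. Re (g z))" "real_polynomial_function (\<lambda>z. Im (g z))"
    using g(1) bounded_linear_Re bounded_linear_Im unfolding polynomial_function_def comp_def by auto
  from rpf[OF this(1)] trig_monom_mult[OF rpf[OF this(2)], of 0 \<int> \<i>]
  have "trig \<int> (\<lambda>x. complex_of_real (Re (g (ec x))) + \<i> * complex_of_real (Im (g (ec x))))"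
    by (intro trig_add) auto
  then have "trig \<int> (\<lambda>x. g (ec x))" by (simp add: complex_eq[symmetric])
  then show thesis using g(2) by (intro that[of "\<lambda>x. g (ec x)"]) (auto simp: dist_norm)
qed

subsection \<open>Functions of the fractional part\<close>

lemma ec_eq_iff: "ec x = ec y \<longleftrightarrow> x - y \<in> \<int>"
proof -
  have "ec x = ec (x - y) * ec y" by (simp add: ec_add[symmetric])
  then show ?thesis by (metis ec_eq_1_iff mult_cancel_right1 mult_1 norm_ec norm_zero zero_neq_one)
qed

lemma ec_frac: "ec (frac x) = ec x"
  unfolding ec_eq_iff by (simp add: frac_def)

text \<open>Makes a function of \<open>frac x\<close> a function of the point \<open>ec x\<close> of
  the circle; the jump of \<open>frac\<close> sits at the point 1.\<close>

lemma Arg2pi_ec: "Arg2pi (ec x) = 2 * pi * frac x"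
proof (rule Arg2pi_unique[of 1])
  have "exp (\<i> * complex_of_real (2 * pi * frac x)) = ec (frac x)"
    by (simp only: ec_def cis_conv_exp)
  then show "complex_of_real 1 * exp (\<i> * complex_of_real (2 * pi * frac x)) = ec x"
    by (simp add: ec_frac)
  show "2 * pi * frac x < 2 * pi" using frac_lt_1[of x] by simp
qed auto

text \<open>Two visits of \<open>n * \<beta>\<close> to a tiny neighbourhood of \<open>0\<close> modulo 1 are far apart in time.\<close>

lemma returns_to_1_sparse:
  assumes irr: "\<beta> \<notin> \<rat>" and "\<epsilon> > 0"
  obtains \<delta> where "\<delta> > 0"
    "\<forall>\<^sub>F N in sequentially. cesaro (\<lambda>n. if norm (ec (\<beta> * real n) - 1) < \<delta> then 1 else 0 :: real) N < \<epsilon>"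
proof -
  obtain K :: nat where K0: "K > 0" and K: "1 / real K < \<epsilon> / 2"
    using \<open>\<epsilon> > 0\<close> by (metis half_gt_zero nat_approx_posE zero_less_Suc)
  \<comment> \<open>At most half the distance from 1 of every \<open>ec (\<beta> * j)\<close> with
    \<open>1 \<le> j < K\<close>. The inserted 1 keeps the set nonempty when
    \<open>K = 1\<close>.\<close>
  define \<delta> where "\<delta> = Min (insert 1 ((\<lambda>j. norm (ec (\<beta> * real j) - 1)) ` {1..<K})) / 2"
  have nz: "ec (\<beta> * real j) \<noteq> 1" if "j \<ge> 1" for j
  proof
    assume "ec (\<beta> * real j) = 1"
    then have "real j * \<beta> \<in> \<rat>" unfolding ec_eq_1_iff using Ints_subset_Rats by (metis mult.commute subsetD)
    then show False using Rats_mult_cancel[of "real j" \<beta>] irr that by simp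
  qed
  have d: "\<delta> > 0" unfolding \<delta>_def using nz by (auto simp: Min_gr_iff)
  have gap: "2 * \<delta> \<le> norm (ec (\<beta> * real j) - 1)" if "j \<ge> 1" "j < K" for j
  proof -
    have "Min (insert 1 ((\<lambda>j. norm (ec (\<beta> * real j) - 1)) ` {1..<K})) \<le> norm (ec (\<beta> * real j) - 1)"
      by (rule Min_le) (use that in auto)
    then show ?thesis by (simp add: \<delta>_def)
  qed
  let ?w = "\<lambda>n. if norm (ec (\<beta> * real n) - 1) < \<delta> then 1 else 0 :: real"
  have "(\<Sum>j<K. ?w (n + j)) \<le> 1" for n
  proof -
    let ?J = "{j. j < K \<and> norm (ec (\<beta> * real (n + j)) - 1) < \<delta>}"
    \<comment> \<open>Two close visits at times \<open>i < j\<close> of one window would bring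
      \<open>ec (\<beta> * (j - i))\<close> within \<open>2 * \<delta>\<close> of 1.\<close>
    have clash: False if "i \<in> ?J" "j \<in> ?J" "i < j" for i j
    proof -
      have "ec (\<beta> * real (n + j)) = ec (\<beta> * real (j - i)) * ec (\<beta> * real (n + i))"
        using \<open>i < j\<close> by (simp add: ec_add[symmetric] algebra_simps)
      then have "ec (\<beta> * real (n + j)) - ec (\<beta> * real (n + i)) = (ec (\<beta> * real (j - i)) - 1) * ec (\<beta> * real (n + i))"
        by (simp add: algebra_simps)
      then have "norm (ec (\<beta> * real (j - i)) - 1) = norm (ec (\<beta> * real (n + j)) - ec (\<beta> * real (n + i)))"
        by (simp add: norm_mult)
      also have "\<dots> < \<delta> + \<delta>"
        using that norm_triangle_ineq4[of "ec (\<beta> * real (n + j)) - 1" "ec (\<beta> * real (n + i)) - 1"] by simp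
      finally have "norm (ec (\<beta> * real (j - i)) - 1) < \<delta> + \<delta>" .
      moreover have "1 \<le> j - i" "j - i < K" using that by auto
      ultimately show False using gap[of "j - i"] by linarith
    qed
    have "card ?J \<le> 1"
    proof -
      have "finite ?J" by simp
      then show ?thesis
        unfolding One_nat_def card_le_Suc0_iff_eq[OF \<open>finite ?J\<close>]
      proof (intro ballI)
        fix i j assume "i \<in> ?J" "j \<in> ?J"
        then show "i = j" using clash[of i j] clash[of j i] by (cases i j rule: linorder_cases) simp_all
      qed
    qed
    moreover have "(\<Sum>j<K. ?w (n + j)) = real (card ?J)"
      by (simp add: sum.If_cases Int_def lessThan_def)
    ultimately show ?thesis by simp
  qed
  from cesaro_sparse[of ?w, OF _ _ K0 this, of "\<epsilon> / 2"]
  have "\<forall>\<^sub>F N in sequentially. cesaro ?w N < 1 / real K + \<epsilon> / 2" using \<open>\<epsilon> > 0\<close> by auto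
  then have "\<forall>\<^sub>F N in sequentially. cesaro ?w N < \<epsilon>"
    by (rule eventually_mono) (use K in auto)
  with d show thesis by (rule that)
qed

text \<open>\<open>Arg2pi\<close> is continuous off the nonnegative real axis, which meets the unit
  circle only at 1.\<close>

lemma isCont_compose_Arg2pi:
  fixes \<psi> :: "real \<Rightarrow> complex"
  assumes cont: "continuous_on UNIV \<psi>" and z: "norm z = 1" "z \<noteq> 1"
  shows "isCont (\<lambda>z. \<psi> (Arg2pi z / (2 * pi))) z"
proof -
  have "z \<notin> \<real>\<^sub>\<ge>\<^sub>0"
    using z by (auto elim!: nonneg_Reals_cases)
  then have "isCont Arg2pi z" by (rule continuous_at_Arg2pi)
  moreover have "isCont \<psi> (Arg2pi z / (2 * pi))" using cont by (simp add: continuous_on_eq_continuous_at)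
  ultimately show ?thesis
    by (intro isCont_o2[of z "\<lambda>z. Arg2pi z / (2 * pi)" \<psi>] continuous_intros) auto
qed

text \<open>The values of \<open>\<psi>\<close> at 0 and 1 may differ, which gives a jump at the
  point 1 of the circle. A cutoff there restores continuity, hence uniform approximability, and it
  alters only the rare terms with \<open>n * \<beta>\<close> near an integer.\<close>

lemma besicovitch_frac:
  fixes \<psi> :: "real \<Rightarrow> complex"
  assumes irr: "\<beta> \<notin> \<rat>" and cont: "continuous_on UNIV \<psi>"
  shows "besicovitch {of_int k * \<beta> |k. True} (\<lambda>n. \<psi> (frac (real n * \<beta>)))"
  unfolding besicovitch_def
proof (intro conjI allI impI)
  have "compact (\<psi> ` {0..1})"
    by (intro compact_continuous_image continuous_on_subset[OF cont]) auto
  then obtain C where C: "C > 0" "\<And>x. x \<in> {0..1} \<Longrightarrow> norm (\<psi> x) \<le> C"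
    using compact_imp_bounded bounded_pos by (metis imageI)
  have C': "norm (\<psi> (frac x)) \<le> C" for x
    using frac_lt_1[of x] by (intro C(2)) auto
  then show "\<exists>C. \<forall>n. norm (\<psi> (frac (real n * \<beta>))) \<le> C" by blast
  fix \<epsilon> :: real assume e: "\<epsilon> > 0"
  \<comment> \<open>The cutoff changes a value by at most \<open>C\<close>, so visits of this
    density cost at most \<open>\<epsilon> / 2\<close> in mean.\<close>
  then have "\<epsilon> / (2 * C) > 0" using C(1) by simp
  then obtain \<delta> where d: "\<delta> > 0" and sparse:
    "\<forall>\<^sub>F N in sequentially. cesaro (\<lambda>n. if norm (ec (\<beta> * real n) - 1) < \<delta> then 1 else 0 :: real) N < \<epsilon> / (2 * C)"
    using returns_to_1_sparse[OF irr] by blast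
  define \<eta> where "\<eta> z = min 1 (norm (z - 1) / \<delta>)" for z :: complex
  define f where "f z = of_real (\<eta> z) * \<psi> (Arg2pi z / (2 * pi))" for z :: complex
  have f_ec: "f (ec x) = of_real (\<eta> (ec x)) * \<psi> (frac x)" for x
    by (simp add: f_def Arg2pi_ec)
  have \<eta>: "0 \<le> \<eta> z" "\<eta> z \<le> 1" for z using d by (auto simp: \<eta>_def)
  have \<eta>_cont: "isCont \<eta> z" for z
    unfolding \<eta>_def using d by (intro continuous_intros) auto
  have f_le: "norm (f z) \<le> \<eta> z * C" for z
  proof -
    have "norm (\<psi> (Arg2pi z / (2 * pi))) \<le> C"
      using Arg2pi[of z] by (intro C(2)) (auto simp: field_simps)
    then show ?thesis using \<eta>[of z] by (simp add: f_def norm_mult mult_left_mono)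
  qed
  have "isCont f z" if "norm z = 1" for z
  proof (cases "z = 1")
    case True
    \<comment> \<open>At the point 1 the factor with \<open>Arg2pi\<close> may jump, but it is
      bounded by \<open>C\<close> while \<open>\<eta>\<close> tends to 0.\<close>
    have "((\<lambda>z. \<eta> z * C) \<longlongrightarrow> \<eta> 1 * C) (at 1)"
      using \<eta>_cont[of 1] unfolding isCont_def by (intro tendsto_intros)
    then have "(f \<longlongrightarrow> 0) (at 1)"
      by (intro Lim_null_comparison[of f "\<lambda>z. \<eta> z * C"]) (use f_le in \<open>auto simp: \<eta>_def\<close>)
    moreover have "f 1 = 0" by (simp add: f_def \<eta>_def)
    ultimately show ?thesis using True by (simp add: isCont_def)
  next
    case False
    then have "isCont (\<lambda>z. \<psi> (Arg2pi z / (2 * pi))) z"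
      using isCont_compose_Arg2pi[OF cont that] by simp
    then show ?thesis
      unfolding f_def using \<eta>_cont[of z] by (intro continuous_intros)
  qed
  then have "continuous_on (sphere 0 1) f"
    by (auto intro!: continuous_at_imp_continuous_on)
  moreover have "\<epsilon> / 2 > 0" using e by simp
  ultimately obtain T where T: "trig \<int> T" "\<And>x. norm (f (ec x) - T x) < \<epsilon> / 2"
    by (rule circle_trig_approx) blast
  have "trig {of_int k * \<beta> |k. True} (\<lambda>x. T (\<beta> * x))"
    using T(1) by (rule trig_scale) (auto elim!: Ints_cases)
  moreover from sparse
  have "\<forall>\<^sub>F N in sequentially. cesaro (\<lambda>n. norm (\<psi> (frac (real n * \<beta>)) - T (\<beta> * real n))) N < \<epsilon>"
  proof eventually_elim
    case (elim N)
    let ?w = "\<lambda>n. if norm (ec (\<beta> * real n) - 1) < \<delta> then 1 else 0 :: real"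
    have "cesaro (\<lambda>n. norm (\<psi> (frac (real n * \<beta>)) - T (\<beta> * real n))) N \<le>
       cesaro (\<lambda>n. C * ?w n + \<epsilon> / 2) N"
    proof (rule cesaro_mono)
      fix n
      let ?x = "\<beta> * real n"
      have "norm (\<psi> (frac ?x) - f (ec ?x)) \<le> C * ?w n"
      proof (cases "norm (ec ?x - 1) < \<delta>")
        case True
        have "\<psi> (frac ?x) - f (ec ?x) = of_real (1 - \<eta> (ec ?x)) * \<psi> (frac ?x)"
          by (simp add: f_ec algebra_simps)
        also have "norm \<dots> \<le> 1 * C"
          unfolding norm_mult norm_of_real using \<eta>[of "ec ?x"] C'[of ?x] by (intro mult_mono) auto
        finally show ?thesis using True by simp
      next
        case False
        then have "\<eta> (ec ?x) = 1" using d by (simp add: \<eta>_def)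
        then show ?thesis using False by (simp add: f_ec)
      qed
      then show "norm (\<psi> (frac (real n * \<beta>)) - T (\<beta> * real n)) \<le> C * ?w n + \<epsilon> / 2"
        using T(2)[of ?x] norm_triangle_ineq[of "\<psi> (frac ?x) - f (ec ?x)" "f (ec ?x) - T ?x"]
        by (simp add: mult.commute)
    qed
    also have "\<dots> \<le> C * cesaro ?w N + \<epsilon> / 2"
      using cesaro_const_le[of "\<epsilon> / 2" N] e by (simp add: cesaro_add cesaro_mult)
    also have "\<dots> < C * (\<epsilon> / (2 * C)) + \<epsilon> / 2"
      using elim C(1) by (intro add_strict_right_mono mult_strict_left_mono)
    also have "C * (\<epsilon> / (2 * C)) = \<epsilon> / 2" using C(1) by simp
    finally show ?case by simp
  qed
  ultimately show "\<exists>T. trig {of_int k * \<beta> |k. True} T \<and>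
      (\<forall>\<^sub>F N in sequentially. cesaro (\<lambda>n. norm (\<psi> (frac (real n * \<beta>)) - T (real n))) N < \<epsilon>)"
    by blast
qed

subsection \<open>Correlations of bracket polynomials\<close>

text \<open>The possible values of \<open>c\<close> are those of the difference of \<open>floor (x * \<beta>)\<close> over a step \<open>h\<close>;
  on the set of \<open>n\<close> where the value \<open>c\<close> occurs, the discrete derivative of
  \<open>n * \<alpha> * floor (n * \<beta>)\<close> is, up to a function of \<open>n * \<beta>\<close> modulo 1, linear in \<open>n\<close>
  with the slope \<open>\<alpha> * c + h * \<alpha> * \<beta>\<close>.\<close>

definition corr_freqs :: "nat \<Rightarrow> real \<Rightarrow> real \<Rightarrow> real set" where
  "corr_freqs h \<alpha> \<beta> = {\<alpha> * of_int c + real h * \<alpha> * \<beta> + of_int k * \<beta> |c k.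
     c = \<lfloor>real h * \<beta>\<rfloor> \<or> c = \<lfloor>real h * \<beta>\<rfloor> + 1}"

text \<open>With \<open>d n\<close> and \<open>g\<close> as in the proof, the exponent is \<open>h *
  h * \<alpha> * \<beta> + g * n + n * \<alpha> * d n - h * \<alpha> * frac ((n + h) *
  \<beta>)\<close>. Each term gives a factor of known frequencies, and these add up to
  \<open>corr_freqs\<close>.\<close>

lemma besicovitch_correlation:
  assumes irr: "\<beta> \<notin> \<rat>"
  shows "besicovitch (corr_freqs h \<alpha> \<beta>)
    (\<lambda>n. ec (real (n + h) * \<alpha> * of_int \<lfloor>real (n + h) * \<beta>\<rfloor> - real n * \<alpha> * of_int \<lfloor>real n * \<beta>\<rfloor>))"
proof -
  define Z where "Z = {of_int k * \<beta> |k. True}"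
  have Z0: "0 \<in> Z" unfolding Z_def by (rule CollectI, rule exI[of _ 0]) simp
  have Zadd: "x + y \<in> Z" if "x \<in> Z" "y \<in> Z" for x y
  proof -
    from that obtain k l where "x = of_int k * \<beta>" "y = of_int l * \<beta>" by (auto simp: Z_def)
    then have "x + y = of_int (k + l) * \<beta>" by (simp add: distrib_right)
    then show ?thesis unfolding Z_def by blast
  qed
  \<comment> \<open>The carry in adding the two fractional parts, written through
    \<open>frac\<close> so that \<open>besicovitch_frac\<close> applies.\<close>
  define d where "d n = frac (real n * \<beta>) + frac (real h * \<beta>) - frac (real (n + h) * \<beta>)" for n
  have fr: "besicovitch Z (\<lambda>n. \<psi> (frac (real n * \<beta>)))" if "continuous_on UNIV \<psi>" for \<psi>
    unfolding Z_def by (rule besicovitch_frac[OF irr that])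
  have "besicovitch Z (\<lambda>n. complex_of_real (frac (real n * \<beta>)))"
    by (rule fr) (intro continuous_intros)
  then have "besicovitch Z (\<lambda>n. complex_of_real (frac (real n * \<beta>)) +
      (of_real (frac (real h * \<beta>)) + (-1) * of_real (frac (real (n + h) * \<beta>))))"
    by (intro besicovitch_add besicovitch_cmult besicovitch_const Z0
          besicovitch_shift[of Z "\<lambda>n. complex_of_real (frac (real n * \<beta>))"])
  then have D: "besicovitch Z (\<lambda>n. complex_of_real (d n))"
    by (simp add: d_def add_diff_eq)
  have D01: "d n = 0 \<or> d n = 1" and fl: "of_int \<lfloor>real (n + h) * \<beta>\<rfloor> = of_int \<lfloor>real n * \<beta>\<rfloor> + of_int \<lfloor>real h * \<beta>\<rfloor> + d n" for n
    using frac_add[of "real n * \<beta>" "real h * \<beta>"] 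
    by (auto simp: d_def frac_def distrib_right split: if_splits)
  define A where "A = {0, \<alpha>}"
  define ZA where "ZA = {a + z |a z. a \<in> A \<and> z \<in> Z}"
  have "besicovitch Z (\<lambda>n. 1 + (-1) * complex_of_real (d n))"
    by (intro besicovitch_add besicovitch_cmult D besicovitch_const Z0)
  moreover have "Z \<subseteq> ZA" unfolding ZA_def A_def by force
  ultimately have "besicovitch ZA (\<lambda>n. 1 + (-1) * complex_of_real (d n))" by (rule besicovitch_mono)
  moreover have "besicovitch ZA (\<lambda>n. (1 * ec (\<alpha> * real n)) * complex_of_real (d n))"
    by (rule besicovitch_mult[OF besicovitch_monom[of \<alpha> A] D]) (auto simp: A_def ZA_def)
  ultimately have "besicovitch ZA (\<lambda>n. 1 + (-1) * complex_of_real (d n) + (1 * ec (\<alpha> * real n)) * complex_of_real (d n))"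
    by (rule besicovitch_add)
  \<comment> \<open>As \<open>d n\<close> is 0 or 1, the exponential is an affine function of it;
    this resolves the product of \<open>n\<close> with a function of \<open>n * \<beta>\<close>
    modulo 1 in the exponent.\<close>
  moreover have "1 + (-1) * complex_of_real (d n) + (1 * ec (\<alpha> * real n)) * complex_of_real (d n) = ec (real n * \<alpha> * d n)" for n
    using D01[of n] by (auto simp: mult.commute)
  ultimately have B1: "besicovitch ZA (\<lambda>n. ec (real n * \<alpha> * d n))" by simp
  have "besicovitch Z (\<lambda>n. ec (- (real h * \<alpha>) * frac (real n * \<beta>)))"
    unfolding ec_def by (rule fr[of "\<lambda>x. cis (2 * pi * (- (real h * \<alpha>) * x))"]) (intro continuous_intros)
  from besicovitch_shift[OF this, of h]
  have "besicovitch Z (\<lambda>n. ec (- (real h * \<alpha>) * frac (real (n + h) * \<beta>)))" .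
  then have B2: "besicovitch ZA (\<lambda>n. ec (real n * \<alpha> * d n) * ec (- (real h * \<alpha>) * frac (real (n + h) * \<beta>)))"
  proof (rule besicovitch_mult[OF B1])
    fix f g assume "f \<in> ZA" "g \<in> Z"
    then show "f + g \<in> ZA" unfolding ZA_def using Zadd by (force simp: add.assoc)
  qed
  define g where "g = \<alpha> * of_int \<lfloor>real h * \<beta>\<rfloor> + real h * \<alpha> * \<beta>"
  have "besicovitch (corr_freqs h \<alpha> \<beta>) (\<lambda>n. (ec (real h * real h * \<alpha> * \<beta>) * ec (g * real n)) *
      (ec (real n * \<alpha> * d n) * ec (- (real h * \<alpha>) * frac (real (n + h) * \<beta>))))"
  proof (rule besicovitch_mult[OF besicovitch_monom[of g "{g}"] B2])
    fix x y assume "x \<in> {g}" "y \<in> ZA"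
    then obtain a k where "a = 0 \<or> a = \<alpha>" "x = g" "y = a + of_int k * \<beta>"
      by (auto simp: ZA_def A_def Z_def)
    \<comment> \<open>Choosing the frequency \<open>\<alpha>\<close> from the carry factor raises
      the floor difference by one.\<close>
    moreover define c where "c = \<lfloor>real h * \<beta>\<rfloor> + (if a = 0 then 0 else 1)"
    ultimately have "x + y = \<alpha> * of_int c + real h * \<alpha> * \<beta> + of_int k * \<beta>"
      by (auto simp: g_def algebra_simps)
    moreover have "c = \<lfloor>real h * \<beta>\<rfloor> \<or> c = \<lfloor>real h * \<beta>\<rfloor> + 1" by (simp add: c_def)
    ultimately show "x + y \<in> corr_freqs h \<alpha> \<beta>" unfolding corr_freqs_def by blast
  qed simp
  moreover have "(ec (real h * real h * \<alpha> * \<beta>) * ec (g * real n)) *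
      (ec (real n * \<alpha> * d n) * ec (- (real h * \<alpha>) * frac (real (n + h) * \<beta>))) =
      ec (real (n + h) * \<alpha> * of_int \<lfloor>real (n + h) * \<beta>\<rfloor> - real n * \<alpha> * of_int \<lfloor>real n * \<beta>\<rfloor>)" for n
  proof -
    have eq: "frac (real (n + h) * \<beta>) = real (n + h) * \<beta> - (of_int \<lfloor>real n * \<beta>\<rfloor> + of_int \<lfloor>real h * \<beta>\<rfloor> + d n)"
      using fl[of n] by (simp add: frac_def)
    show ?thesis unfolding ec_add[symmetric] eq fl
      by (rule arg_cong[of _ _ ec]) (simp add: g_def algebra_simps)
  qed
  ultimately show ?thesis by simp
qed

section \<open>Consequences of linear independence over the rationals\<close>

lemma Q_lin_indepD:
  assumes "Q_lin_indep_1_ab m \<alpha> \<beta>"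
    and "of_rat c + (\<Sum>i<m. of_rat (a i) * \<alpha> i) + (\<Sum>i<m. of_rat (b i) * \<beta> i) = 0"
  shows "c = 0 \<and> (\<forall>i<m. a i = 0 \<and> b i = 0)"
  by (rule assms(1)[unfolded Q_lin_indep_1_ab_def, THEN spec, THEN spec, THEN spec, THEN mp, OF assms(2)])

lemma Q_lin_indepD_int:
  fixes a b :: "nat \<Rightarrow> int"
  assumes "Q_lin_indep_1_ab m \<alpha> \<beta>"
    and "(\<Sum>i<m. of_int (a i) * \<alpha> i) + (\<Sum>i<m. of_int (b i) * \<beta> i) \<in> \<rat>" and "i < m"
  shows "a i = 0 \<and> b i = 0"
proof -
  obtain r where r: "(\<Sum>i<m. of_int (a i) * \<alpha> i) + (\<Sum>i<m. of_int (b i) * \<beta> i) = of_rat r"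
    using assms(2) by (auto elim: Rats_cases)
  have "of_rat (- r) + (\<Sum>i<m. of_rat (of_int (a i)) * \<alpha> i) + (\<Sum>i<m. of_rat (of_int (b i)) * \<beta> i) = 0"
    using r by (simp add: of_rat_minus)
  from Q_lin_indepD[OF assms(1) this] \<open>i < m\<close> show ?thesis by simp
qed

lemma Q_lin_indep_irrational:
  assumes "Q_lin_indep_1_ab m \<alpha> \<beta>" "i < m"
  shows "\<beta> i \<notin> \<rat>"
proof
  assume "\<beta> i \<in> \<rat>"
  have "(\<Sum>j<m. of_int (if j = i then 1 else 0) * \<beta> j) = (\<Sum>j<m. if j = i then \<beta> j else 0)"
    by (intro sum.cong) auto
  also have "\<dots> = \<beta> i" using assms(2) by simp
  finally have "(\<Sum>j<m. of_int 0 * \<alpha> j) + (\<Sum>j<m. of_int (if j = i then 1 else 0) * \<beta> j) \<in> \<rat>"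
    using \<open>\<beta> i \<in> \<rat>\<close> by simp
  from Q_lin_indepD_int[OF assms(1) this assms(2)] show False by simp
qed

text \<open>The frequency \<open>k\<close> of an approximating trigonometric polynomial multiplies
  the bracket expression by \<open>k\<close>; the factor is absorbed into the numbers
  \<open>\<alpha> i\<close>.\<close>

lemma Q_lin_indep_scale:
  assumes "Q_lin_indep_1_ab m \<alpha> \<beta>" "k \<noteq> 0"
  shows "Q_lin_indep_1_ab m (\<lambda>i. of_int k * \<alpha> i) \<beta>"
  unfolding Q_lin_indep_1_ab_def
proof (intro allI impI)
  fix c :: rat and a b :: "nat \<Rightarrow> rat"
  assume "of_rat c + (\<Sum>i<m. of_rat (a i) * (of_int k * \<alpha> i)) + (\<Sum>i<m. of_rat (b i) * \<beta> i) = 0"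
  then have "of_rat c + (\<Sum>i<m. of_rat (a i * of_int k) * \<alpha> i) + (\<Sum>i<m. of_rat (b i) * \<beta> i) = 0"
    by (simp add: of_rat_mult mult.assoc)
  from Q_lin_indepD[OF assms(1) this] \<open>k \<noteq> 0\<close>
  show "c = 0 \<and> (\<forall>i<m. a i = 0 \<and> b i = 0)" by simp
qed

text \<open>If \<open>P\<close> had an irrational coefficient of index above 2, the last one, at
  \<open>M\<close>, would make the coefficient at \<open>M - 1 > 1\<close> irrational, where
  \<open>[:0, g:]\<close> contributes nothing. So the linear coefficient is
  \<open>g + 2 * h * coeff P 2\<close> up to a rational.\<close>

lemma rational_diff_poly:
  fixes P :: "real poly"
  assumes h: "h \<ge> 1" and rat: "\<And>j. j \<ge> 1 \<Longrightarrow> coeff ([:0, g:] + diff_poly (real h) P) j \<in> \<rat>"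
  shows "g + 2 * real h * coeff P 2 \<in> \<rat>"
proof -
  have high: "coeff P j \<in> \<rat>" if "j > 2" for j
  proof (rule ccontr)
    assume "coeff P j \<notin> \<rat>"
    then obtain M where M: "M \<ge> j" "coeff P M \<notin> \<rat>" "\<And>k. k > M \<Longrightarrow> coeff P k \<in> \<rat>"
      using top_irrational_coeff by blast
    then have "M > 2" using \<open>j > 2\<close> by simp
    have 1: "coeff (diff_poly (real h) P) (M - 1) - (real M * real h) * coeff P M \<in> \<rat>"
      using M \<open>M > 2\<close> by (intro coeff_diff_poly_Rats) auto
    have "coeff [:0, g:] (M - 1) = 0"
      using \<open>M > 2\<close> by (simp add: coeff_pCons split: nat.split)
    then have "coeff (diff_poly (real h) P) (M - 1) \<in> \<rat>"
      using rat[of "M - 1"] \<open>M > 2\<close> by simp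
    from Rats_diff[OF this 1] have "(real M * real h) * coeff P M \<in> \<rat>" by simp
    moreover have "real M * real h \<in> \<rat>" "real M * real h \<noteq> 0" using \<open>M > 2\<close> h by auto
    ultimately show False using M(2) Rats_mult_cancel by blast
  qed
  have 1: "coeff (diff_poly (real h) P) (2 - 1) - real 2 * real h * coeff P 2 \<in> \<rat>"
    using high by (intro coeff_diff_poly_Rats) auto
  have "g + coeff (diff_poly (real h) P) 1 \<in> \<rat>" using rat[of 1] by simp
  from Rats_diff[OF this 1]
  show ?thesis by simp
qed

text \<open>For a bad \<open>h\<close> the integers \<open>c i\<close> approximate \<open>h * \<beta> i\<close> up to 1. Eliminating the
  unknown quadratic coefficient between two bad values of \<open>h\<close> shows that \<open>c i / h\<close> does not
  depend on \<open>h\<close>, so infinitely many bad \<open>h\<close> would make \<open>\<beta> i\<close> rational.\<close>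

lemma correlation_poly_irrational:
  assumes indep: "Q_lin_indep_1_ab m \<alpha> \<beta>" and m: "m \<ge> 1"
  shows "\<exists>h0>0. \<forall>h\<ge>h0. \<forall>f. (\<forall>i<m. f i \<in> corr_freqs h (\<alpha> i) (\<beta> i)) \<longrightarrow>
       (\<exists>j\<ge>1. coeff ([:0, \<Sum>i<m. f i:] + diff_poly (real h) P) j \<notin> \<rat>)"
proof (rule ccontr)
  assume "\<not> ?thesis"
  then have ex_bad: "\<exists>h f. h \<ge> h0 \<and> (\<forall>i<m. f i \<in> corr_freqs h (\<alpha> i) (\<beta> i)) \<and>
      (\<forall>j\<ge>1. coeff ([:0, \<Sum>i<m. f i:] + diff_poly (real h) P) j \<in> \<rat>)" if "h0 > 0" for h0
    using that by blast
  \<comment> \<open>All unknown constants that enter a relation with the factor \<open>h\<close>: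
    the products from the frequencies and the quadratic coefficient of \<open>P\<close>.\<close>
  define \<gamma> where "\<gamma> = (\<Sum>i<m. \<alpha> i * \<beta> i) + 2 * coeff P 2"
  have relation: "\<exists>c k. (\<forall>i<m. c i = \<lfloor>real h * \<beta> i\<rfloor> \<or> c i = \<lfloor>real h * \<beta> i\<rfloor> + 1) \<and>
      (\<Sum>i<m. of_int (c i) * \<alpha> i) + (\<Sum>i<m. of_int (k i) * \<beta> i) + real h * \<gamma> \<in> \<rat>"
    if h: "h \<ge> 1" and f: "\<forall>i<m. f i \<in> corr_freqs h (\<alpha> i) (\<beta> i)"
      and rat: "\<forall>j\<ge>1. coeff ([:0, \<Sum>i<m. f i:] + diff_poly (real h) P) j \<in> \<rat>" for h f
  proof -
    have "\<forall>i. \<exists>c k. i < m \<longrightarrow> (f i = \<alpha> i * of_int c + real h * \<alpha> i * \<beta> i + of_int k * \<beta> i \<and>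
        (c = \<lfloor>real h * \<beta> i\<rfloor> \<or> c = \<lfloor>real h * \<beta> i\<rfloor> + 1))"
      using f unfolding corr_freqs_def by blast
    then obtain c k where ck: "\<And>i. i < m \<Longrightarrow> f i = \<alpha> i * of_int (c i) + real h * \<alpha> i * \<beta> i + of_int (k i) * \<beta> i"
        "\<And>i. i < m \<Longrightarrow> c i = \<lfloor>real h * \<beta> i\<rfloor> \<or> c i = \<lfloor>real h * \<beta> i\<rfloor> + 1"
      by metis
    have "(\<Sum>i<m. f i) + 2 * real h * coeff P 2 \<in> \<rat>"
      by (rule rational_diff_poly[OF h]) (use rat in blast)
    also have "(\<Sum>i<m. f i) = (\<Sum>i<m. of_int (c i) * \<alpha> i) + (\<Sum>i<m. of_int (k i) * \<beta> i) + real h * (\<Sum>i<m. \<alpha> i * \<beta> i)"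
      unfolding sum_distrib_left sum.distrib[symmetric]
      by (intro sum.cong refl) (simp add: ck(1) algebra_simps)
    finally have "(\<Sum>i<m. of_int (c i) * \<alpha> i) + (\<Sum>i<m. of_int (k i) * \<beta> i) + real h * \<gamma> \<in> \<rat>"
      by (simp add: \<gamma>_def algebra_simps)
    with ck(2) show ?thesis by blast
  qed
  have bad: "\<exists>h c k. h \<ge> h0 \<and> (\<forall>i<m. c i = \<lfloor>real h * \<beta> i\<rfloor> \<or> c i = \<lfloor>real h * \<beta> i\<rfloor> + 1) \<and>
      (\<Sum>i<m. of_int (c i) * \<alpha> i) + (\<Sum>i<m. of_int (k i) * \<beta> i) + real h * \<gamma> \<in> \<rat>" if h0: "h0 > 0" for h0
  proof -
    obtain h f where hf: "h \<ge> h0" "\<forall>i<m. f i \<in> corr_freqs h (\<alpha> i) (\<beta> i)"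
        "\<forall>j\<ge>1. coeff ([:0, \<Sum>i<m. f i:] + diff_poly (real h) P) j \<in> \<rat>"
      using ex_bad[OF h0] by blast
    have "h \<ge> 1" using hf(1) h0 by simp
    from relation[OF this hf(2,3)] hf(1) show ?thesis by blast
  qed
  obtain h1 c1 k1 where h1: "h1 \<ge> 1"
    and rel1: "(\<Sum>i<m. of_int (c1 i) * \<alpha> i) + (\<Sum>i<m. of_int (k1 i) * \<beta> i) + real h1 * \<gamma> \<in> \<rat>"
    using bad[of 1] by auto
  have irr: "\<beta> 0 \<notin> \<rat>" using Q_lin_indep_irrational[OF indep] m by simp
  define \<delta> where "\<delta> = \<bar>real h1 * \<beta> 0 - of_int (c1 0)\<bar>"
  have \<delta>: "\<delta> > 0"
  proof -
    have "real h1 * \<beta> 0 \<noteq> of_int (c1 0)"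
    proof
      assume "real h1 * \<beta> 0 = of_int (c1 0)"
      then have "real h1 * \<beta> 0 \<in> \<rat>" by simp
      then show False using irr h1 Rats_mult_cancel[of "real h1" "\<beta> 0"] by simp
    qed
    then show ?thesis by (simp add: \<delta>_def)
  qed
  \<comment> \<open>Chosen to contradict the bound \<open>h2 \<le> h1 / \<delta>\<close> reached at
    the end.\<close>
  obtain H :: nat where H: "real H > real h1 / \<delta>" using reals_Archimedean2 by blast
  obtain h2 c2 k2 where h2: "h2 \<ge> Suc H"
    and c2: "\<forall>i<m. c2 i = \<lfloor>real h2 * \<beta> i\<rfloor> \<or> c2 i = \<lfloor>real h2 * \<beta> i\<rfloor> + 1"
    and rel2: "(\<Sum>i<m. of_int (c2 i) * \<alpha> i) + (\<Sum>i<m. of_int (k2 i) * \<beta> i) + real h2 * \<gamma> \<in> \<rat>"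
    using bad[of "Suc H"] by auto
  \<comment> \<open>Cross-multiplication cancels \<open>\<gamma>\<close> and leaves an integer
    combination of the \<open>\<alpha> i\<close> and \<open>\<beta> i\<close>.\<close>
  have "real h2 * ((\<Sum>i<m. of_int (c1 i) * \<alpha> i) + (\<Sum>i<m. of_int (k1 i) * \<beta> i) + real h1 * \<gamma>) -
      real h1 * ((\<Sum>i<m. of_int (c2 i) * \<alpha> i) + (\<Sum>i<m. of_int (k2 i) * \<beta> i) + real h2 * \<gamma>) \<in> \<rat>"
    using rel1 rel2 by (intro Rats_diff Rats_mult) auto
  also have "real h2 * ((\<Sum>i<m. of_int (c1 i) * \<alpha> i) + (\<Sum>i<m. of_int (k1 i) * \<beta> i) + real h1 * \<gamma>) -
      real h1 * ((\<Sum>i<m. of_int (c2 i) * \<alpha> i) + (\<Sum>i<m. of_int (k2 i) * \<beta> i) + real h2 * \<gamma>) =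
      (\<Sum>i<m. of_int (int h2 * c1 i - int h1 * c2 i) * \<alpha> i) + (\<Sum>i<m. of_int (int h2 * k1 i - int h1 * k2 i) * \<beta> i)"
    by (simp add: sum_distrib_left sum_subtractf algebra_simps)
  finally have "int h2 * c1 0 - int h1 * c2 0 = 0"
    using Q_lin_indepD_int[OF indep, of "\<lambda>i. int h2 * c1 i - int h1 * c2 i" "\<lambda>i. int h2 * k1 i - int h1 * k2 i" 0] m
    by simp
  then have "real_of_int (int h2 * c1 0) = real_of_int (int h1 * c2 0)" by simp
  then have "real h2 * (real h1 * \<beta> 0 - of_int (c1 0)) = real h1 * (real h2 * \<beta> 0 - of_int (c2 0))"
    by (simp add: algebra_simps)
  then have "real h2 * \<delta> = real h1 * \<bar>real h2 * \<beta> 0 - of_int (c2 0)\<bar>"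
    unfolding \<delta>_def by (metis abs_mult abs_of_nat)
  also have "\<dots> \<le> real h1 * 1"
  proof (rule mult_left_mono)
    have "c2 0 = \<lfloor>real h2 * \<beta> 0\<rfloor> \<or> c2 0 = \<lfloor>real h2 * \<beta> 0\<rfloor> + 1" using c2 m by simp
    then show "\<bar>real h2 * \<beta> 0 - of_int (c2 0)\<bar> \<le> 1" by linarith
  qed simp
  finally have "real h2 \<le> real h1 / \<delta>" using \<delta> by (simp add: field_simps)
  with H h2 show False by linarith
qed

theorem cesaro_bracket_poly:
  assumes indep: "Q_lin_indep_1_ab m \<alpha> \<beta>" and m: "m \<ge> 1"
  shows "cesaro (\<lambda>n. ec ((\<Sum>i<m. real n * \<alpha> i * of_int \<lfloor>real n * \<beta> i\<rfloor>) + poly P (real n))) \<longlonglongrightarrow> 0"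
proof -
  obtain h0 where h0: "h0 > 0"
    and good: "\<forall>h\<ge>h0. \<forall>f. (\<forall>i<m. f i \<in> corr_freqs h (\<alpha> i) (\<beta> i)) \<longrightarrow>
       (\<exists>j\<ge>1. coeff ([:0, \<Sum>i<m. f i:] + diff_poly (real h) P) j \<notin> \<rat>)"
    using correlation_poly_irrational[OF indep m, of P] by (elim exE conjE)
  let ?s = "\<lambda>n i. real n * \<alpha> i * of_int \<lfloor>real n * \<beta> i\<rfloor>"
  have ec_sum: "ec (\<Sum>i\<in>I. x i) = (\<Prod>i\<in>I. ec (x i))" if "finite I" for I and x :: "nat \<Rightarrow> real"
    using that by (induction rule: finite_induct) (auto simp: ec_add)
  show ?thesis
  proof (rule van_der_Corput[OF _ _ h0])
    fix h assume h: "h \<ge> h0"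
    let ?D = "diff_poly (real h) P"
    \<comment> \<open>The correlation splits into a bracket part, approximable with known
      frequencies, and a polynomial phase that serves as the bounded weight.\<close>
    have "cesaro (\<lambda>n. (\<Prod>i<m. ec (?s (n + h) i - ?s n i)) * ec (poly ?D (real n))) \<longlonglongrightarrow> 0"
    proof (rule besicovitch_cesaro_tendsto_0)
      show "besicovitch {\<Sum>i<m. f i |f. \<forall>i\<in>{..<m}. f i \<in> corr_freqs h (\<alpha> i) (\<beta> i)}
          (\<lambda>n. \<Prod>i<m. ec (?s (n + h) i - ?s n i))"
        by (intro besicovitch_prod besicovitch_correlation Q_lin_indep_irrational[OF indep]) auto
      fix g assume "g \<in> {\<Sum>i<m. f i |f. \<forall>i\<in>{..<m}. f i \<in> corr_freqs h (\<alpha> i) (\<beta> i)}"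
      then obtain f where f: "g = (\<Sum>i<m. f i)" "\<forall>i<m. f i \<in> corr_freqs h (\<alpha> i) (\<beta> i)" by auto
      with good h have "\<exists>j\<ge>1. coeff ([:0, g:] + ?D) j \<notin> \<rat>" by simp
      then obtain j where "j \<ge> 1" "coeff ([:0, g:] + ?D) j \<notin> \<rat>" by (elim exE conjE)
      then have "cesaro (\<lambda>n. ec (poly ([:0, g:] + ?D) (real n))) \<longlonglongrightarrow> 0" by (rule weyl_equidistribution)
      then show "cesaro (\<lambda>n. ec (g * real n) * ec (poly ?D (real n))) \<longlonglongrightarrow> 0"
        by (simp add: ec_add mult.commute)
    qed simp
    moreover have "(\<Prod>i<m. ec (?s (n + h) i - ?s n i)) * ec (poly ?D (real n)) =
        ec ((\<Sum>i<m. ?s (n + h) i) + poly P (real (n + h))) * cnj (ec ((\<Sum>i<m. ?s n i) + poly P (real n)))" for n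
      unfolding ec_sum[OF finite_lessThan, symmetric] cnj_ec ec_add[symmetric] poly_diff_poly sum_subtractf
      by (rule arg_cong[of _ _ ec]) simp
    ultimately show "cesaro (\<lambda>n. ec ((\<Sum>i<m. ?s (n + h) i) + poly P (real (n + h))) *
        cnj (ec ((\<Sum>i<m. ?s n i) + poly P (real n)))) \<longlonglongrightarrow> 0"
      by simp
  qed simp
qed

subsection \<open>Continuous functions of the bracket polynomial\<close>

text \<open>Reading the angle from the cut at 1 gives \<open>f\<close>, whose continuity is unclear
  only at 1. There it is compared with \<open>f'\<close>, which has its cut at -1 and agrees with
  \<open>f\<close> on the circle by periodicity.\<close>

lemma periodic_trig_approx:
  fixes \<phi> :: "real \<Rightarrow> complex"
  assumes cont: "continuous_on UNIV \<phi>" and per: "\<And>x. \<phi> (x + 1) = \<phi> x" and e: "\<epsilon> > 0"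
  obtains T where "trig \<int> T" "\<And>x. norm (\<phi> x - T x) < \<epsilon>"
proof -
  interpret periodic_fun_simple' \<phi> by unfold_locales (rule per)
  have \<phi>_frac: "\<phi> (y + frac x) = \<phi> (y + x)" for x y
    using minus_of_int[of "y + x" "\<lfloor>x\<rfloor>"] by (simp add: frac_def algebra_simps)
  define f where "f z = \<phi> (Arg2pi z / (2 * pi))" for z
  have f_ec: "f (ec x) = \<phi> x" for x
    using \<phi>_frac[of 0 x] by (simp add: f_def Arg2pi_ec)
  define f' where "f' z = \<phi> (1 / 2 + Arg2pi (- z) / (2 * pi))" for z
  have minus_ec: "- ec x = ec (x + 1 / 2)" for x
    by (simp add: ec_def minus_cis ring_distribs)
  have f'_ec: "f' (ec x) = \<phi> x" for x
    using \<phi>_frac[of "1 / 2" "x + 1 / 2"] per[of x] by (simp add: f'_def minus_ec Arg2pi_ec add_ac)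
  have "continuous (at z within sphere 0 1) f" if "z \<in> sphere 0 1" for z
  proof (cases "z = 1")
    case False
    then have "isCont f z"
      unfolding f_def using that by (intro isCont_compose_Arg2pi[OF cont]) auto
    then show ?thesis by (rule continuous_at_imp_continuous_at_within)
  next
    case True
    have "isCont (\<lambda>z. \<phi> (1 / 2 + Arg2pi z / (2 * pi))) (- z)"
      using True by (intro isCont_compose_Arg2pi[of "\<lambda>x. \<phi> (1 / 2 + x)"]
          continuous_on_compose2[OF cont] continuous_intros) auto
    then have "isCont f' z"
      unfolding f'_def by (rule isCont_o2[OF isCont_minus[OF continuous_ident]])
    then have "continuous (at z within sphere 0 1) f'" by (rule continuous_at_imp_continuous_at_within)
    moreover have "f' w = f w" if "w \<in> sphere 0 1" for w
    proof -
      have "w = ec (Arg2pi w / (2 * pi))"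
        using that Arg2pi_eq[of w] by (simp add: ec_def cis_conv_exp)
      then show ?thesis by (metis f_ec f'_ec)
    qed
    ultimately show ?thesis
      using \<open>z \<in> sphere 0 1\<close> by (rule_tac continuous_transform_within[of z _ f' 1]) auto
  qed
  then have "continuous_on (sphere 0 1) f" by (simp add: continuous_on_eq_continuous_within)
  then obtain T where "trig \<int> T" "\<And>x. norm (f (ec x) - T x) < \<epsilon>"
    using circle_trig_approx[OF _ e] by blast
  then show thesis using that by (simp add: f_ec)
qed

lemma has_integral_ec:
  assumes "g \<in> \<int>" "g \<noteq> 0"
  shows "((\<lambda>x. ec (g * x)) has_integral 0) {0..1}"
proof -
  define c where "c = 2 * of_real pi * \<i> * of_real g"
  have c: "c \<noteq> 0" using assms by (simp add: c_def)
  have ec_exp: "ec (g * x) = exp (c * of_real x)" for x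
    unfolding ec_def c_def cis_conv_exp by (simp add: mult_ac)
  have "((\<lambda>x. exp (c * of_real x) / c) has_vector_derivative exp (c * of_real x)) (at x within {0..1})" for x
    by (rule has_vector_derivative_real_field) (use c in \<open>auto intro!: derivative_eq_intros\<close>)
  then have "((\<lambda>x. exp (c * of_real x)) has_integral (exp (c * of_real 1) / c - exp (c * of_real 0) / c)) {0..1}"
    by (intro fundamental_theorem_of_calculus) auto
  moreover have "exp (c * of_real 1) = exp (c * of_real 0)"
    using ec_exp[of 1] ec_exp[of 0] assms by simp
  ultimately show ?thesis by (simp add: ec_exp)
qed

theorem theoremC:
  fixes m :: nat and \<alpha> \<beta> :: "nat \<Rightarrow> real" and \<phi> :: "real \<Rightarrow> complex"
  assumes "m \<ge> 1"
    and "Q_lin_indep_1_ab m \<alpha> \<beta>"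
    and "continuous_on UNIV \<phi>"
    and "\<And>x. \<phi> (x + 1) = \<phi> x"
    and "integral {0..1} \<phi> = 0"
  shows "fully_oscillating
           (\<lambda>n. \<phi> (\<Sum>i<m. real n * \<alpha> i * real_of_int \<lfloor>real n * \<beta> i\<rfloor>))"
proof -
  define s where "s n = (\<Sum>i<m. real n * \<alpha> i * real_of_int \<lfloor>real n * \<beta> i\<rfloor>)" for n
  \<comment> \<open>The number \<open>c\<close> is both the integral of \<open>T\<close> and its
    mean along \<open>s\<close>: frequency 0 adds its coefficient to both, every other frequency
    adds 0 to both.\<close>
  have trig: "\<exists>c. (T has_integral c) {0..1} \<and>
      (\<forall>P. cesaro (\<lambda>n. (T (s n) - c) * ec (poly P (real n))) \<longlonglongrightarrow> 0)" if "trig \<int> T" for T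
    using that
  proof (induction rule: trig.induct)
    case zero
    show ?case by (intro exI[of _ 0]) (simp add: cesaro_def[abs_def])
  next
    case (cons g T c)
    then obtain d where d: "(T has_integral d) {0..1}"
      "\<And>P. cesaro (\<lambda>n. (T (s n) - d) * ec (poly P (real n))) \<longlonglongrightarrow> 0" by blast
    show ?case
    proof (cases "g = 0")
      case True
      then have "((\<lambda>x. c * ec (g * x) + T x) has_integral (c + d)) {0..1}"
        using has_integral_add[OF has_integral_const_real[of c 0 1] d(1)] by simp
      then show ?thesis using d(2) True by (intro exI[of _ "c + d"]) simp
    next
      case False
      have int: "((\<lambda>x. c * ec (g * x) + T x) has_integral d) {0..1}"
        using has_integral_add[OF has_integral_mult_right[OF has_integral_ec[OF cons.hyps(1) False], of c] d(1)] by simp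
      obtain k where k: "g = of_int k" using cons.hyps(1) by (auto elim: Ints_cases)
      have "cesaro (\<lambda>n. (c * ec (g * s n) + T (s n) - d) * ec (poly P (real n))) \<longlonglongrightarrow> 0" for P
      proof -
        have "cesaro (\<lambda>n. ec ((\<Sum>i<m. real n * (of_int k * \<alpha> i) * of_int \<lfloor>real n * \<beta> i\<rfloor>) + poly P (real n))) \<longlonglongrightarrow> 0"
          using Q_lin_indep_scale[OF assms(2)] assms(1) False k by (intro cesaro_bracket_poly) auto
        also have "(\<lambda>n. ec ((\<Sum>i<m. real n * (of_int k * \<alpha> i) * of_int \<lfloor>real n * \<beta> i\<rfloor>) + poly P (real n))) =
            (\<lambda>n. ec (g * s n) * ec (poly P (real n)))"
          by (simp add: k s_def sum_distrib_left ec_add mult_ac)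
        finally have "cesaro (\<lambda>n. ec (g * s n) * ec (poly P (real n))) \<longlonglongrightarrow> 0" .
        then have "(\<lambda>N. c * cesaro (\<lambda>n. ec (g * s n) * ec (poly P (real n))) N +
            cesaro (\<lambda>n. (T (s n) - d) * ec (poly P (real n))) N) \<longlonglongrightarrow> c * 0 + 0"
          by (intro tendsto_intros d(2))
        then show ?thesis by (simp add: cesaro_mult[symmetric] cesaro_add[symmetric] algebra_simps)
      qed
      with int show ?thesis by blast
    qed
  qed
  have \<phi>_int: "(\<phi> has_integral 0) {0..1}"
    using integrable_continuous_real[OF continuous_on_subset[OF assms(3)], of 0 1] assms(5)
    by (simp add: has_integral_integral)
  have main: "cesaro (\<lambda>n. \<phi> (s n) * ec (poly P (real n))) \<longlonglongrightarrow> 0" for P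
  proof (rule tendsto_0I_eventually_norm_le)
    fix \<epsilon> :: real assume "\<epsilon> > 0"
    then have e: "\<epsilon> / 3 > 0" by simp
    obtain T where T: "trig \<int> T" "\<And>x. norm (\<phi> x - T x) < \<epsilon> / 3"
      using periodic_trig_approx[OF assms(3,4) e] by blast
    obtain c where c: "(T has_integral c) {0..1}"
      "cesaro (\<lambda>n. (T (s n) - c) * ec (poly P (real n))) \<longlonglongrightarrow> 0"
      using trig[OF T(1)] by blast
    \<comment> \<open>The integral of \<open>\<phi> - T\<close> is \<open>- c\<close>, so the
      uniform bound passes to \<open>c\<close>.\<close>
    have "norm (0 - c) \<le> \<epsilon> / 3 * measure lborel {0..1::real}"
      by (rule has_integral_bound_real[OF _ _ has_integral_diff[OF \<phi>_int c(1)]])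
        (use T(2) e in \<open>auto intro: less_imp_le\<close>)
    then have c_le: "norm c \<le> \<epsilon> / 3" by simp
    from tendstoD[OF c(2) e]
    show "\<forall>\<^sub>F N in sequentially. norm (cesaro (\<lambda>n. \<phi> (s n) * ec (poly P (real n))) N) \<le> \<epsilon>"
    proof eventually_elim
      case (elim N)
      \<comment> \<open>Splitting \<open>\<phi>\<close> as \<open>(\<phi> - T + c) + (T - c)\<close>
        bounds the first part uniformly by \<open>2 * \<epsilon> / 3\<close>, while the second has a
        null mean.\<close>
      have "norm (cesaro (\<lambda>n. (\<phi> (s n) - T (s n) + c) * ec (poly P (real n))) N) \<le>
          cesaro (\<lambda>n. norm ((\<phi> (s n) - T (s n) + c) * ec (poly P (real n)))) N"
        by (rule norm_cesaro_le)
      also have "\<dots> \<le> cesaro (\<lambda>n. 2 * \<epsilon> / 3) N"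
      proof (rule cesaro_mono)
        fix n
        show "norm ((\<phi> (s n) - T (s n) + c) * ec (poly P (real n))) \<le> 2 * \<epsilon> / 3"
          using norm_triangle_ineq[of "\<phi> (s n) - T (s n)" c] T(2)[of "s n"] c_le by (simp add: norm_mult)
      qed
      also have "\<dots> \<le> 2 * \<epsilon> / 3" by (rule cesaro_const_le) (use e in simp)
      finally have "norm (cesaro (\<lambda>n. (\<phi> (s n) - T (s n) + c) * ec (poly P (real n))) N) \<le> 2 * \<epsilon> / 3" .
      moreover have "cesaro (\<lambda>n. \<phi> (s n) * ec (poly P (real n))) N =
          cesaro (\<lambda>n. (\<phi> (s n) - T (s n) + c) * ec (poly P (real n))) N +
          cesaro (\<lambda>n. (T (s n) - c) * ec (poly P (real n))) N"
        by (simp add: cesaro_add[symmetric] algebra_simps)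
      ultimately show ?case
        using elim norm_triangle_ineq[of "cesaro (\<lambda>n. (\<phi> (s n) - T (s n) + c) * ec (poly P (real n))) N"
            "cesaro (\<lambda>n. (T (s n) - c) * ec (poly P (real n))) N"] by simp
    qed
  qed
  have "exp (2 * pi * \<i> * complex_of_real x) = ec x" for x
    by (simp add: ec_def cis_conv_exp mult_ac)
  with main show ?thesis
    unfolding fully_oscillating_def oscillating_of_order_def by (simp add: cesaro_def[abs_def] s_def)
qed

end
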